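(* Let $G$ be a nontrivial finite group and $m,n$ positive integers with $m\leq n$. Then there exists a ring $R$ strongly graded by $G$ such that $\mathrm{gn}(R_1)=n$ and $\mathrm{gn}(R)=m$.
   Context: Rings are unital; "module" means right module. For a ring $S$, the generating number $\mathrm{gn}(S)$ is the smallest positive integer $n$ for which there is an $S$-module epimorphism $S^n\to S^{n+1}$, if such an $n$ exists, and $\mathrm{gn}(S):=\aleph_0$ otherwise. A ring $R$ is strongly graded by a group $G$ if there are additive subgroups $R_g$ ($g\in G$) with $R=\bigoplus_{g\in G}R_g$ as additive groups and $R_gR_h=R_{gh}$ for all $g,h\in G$, where $R_gR_h$ is the additive subgroup generated by products. $R_1$ is the base ring, the component of the identity of $G$. *)

theory Defs
  imports "HOL-Algebra.Module" "HOL-Algebra.AbelCoset" "HOL-Algebra.Generated_Groups" "HOL-Library.Extended_Nat"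
begin

text \<open>
  HOL-Algebra's locale \<open>module\<close> covers (left) modules over commutative rings only, so right modules
  over arbitrary unital rings are set up here on the library's record type. The field \<open>smult\<close> holds
  the right action: \<open>a \<odot>\<^bsub>M\<^esub> x\<close> stands for \<open>x \<cdot> a\<close>, whence the order of the factors in
  \<open>smult_assoc\<close>. The fields \<open>mult\<close> and \<open>one\<close> of \<open>M\<close> are irrelevant.
\<close>

locale right_module = R?: ring R + M?: abelian_group M
  for R :: "('a, 'r) ring_scheme" (structure) and M :: "('a, 'b, 'm) module_scheme" (structure) +
  assumes smult_closed:
      "\<lbrakk> a \<in> carrier R; x \<in> carrier M \<rbrakk> \<Longrightarrow> a \<odot>\<^bsub>M\<^esub> x \<in> carrier M"
    and smult_l_distr:
      "\<lbrakk> a \<in> carrier R; b \<in> carrier R; x \<in> carrier M \<rbrakk> \<Longrightarrow>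
        (a \<oplus>\<^bsub>R\<^esub> b) \<odot>\<^bsub>M\<^esub> x = (a \<odot>\<^bsub>M\<^esub> x) \<oplus>\<^bsub>M\<^esub> (b \<odot>\<^bsub>M\<^esub> x)"
    and smult_r_distr:
      "\<lbrakk> a \<in> carrier R; x \<in> carrier M; y \<in> carrier M \<rbrakk> \<Longrightarrow>
        a \<odot>\<^bsub>M\<^esub> (x \<oplus>\<^bsub>M\<^esub> y) = (a \<odot>\<^bsub>M\<^esub> x) \<oplus>\<^bsub>M\<^esub> (a \<odot>\<^bsub>M\<^esub> y)"
    and smult_assoc:
      "\<lbrakk> a \<in> carrier R; b \<in> carrier R; x \<in> carrier M \<rbrakk> \<Longrightarrow>
        (a \<otimes>\<^bsub>R\<^esub> b) \<odot>\<^bsub>M\<^esub> x = b \<odot>\<^bsub>M\<^esub> (a \<odot>\<^bsub>M\<^esub> x)"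
    and smult_one: "x \<in> carrier M \<Longrightarrow> \<one>\<^bsub>R\<^esub> \<odot>\<^bsub>M\<^esub> x = x"

definition right_module_hom ::
    "('a, 'r) ring_scheme \<Rightarrow> ('a, 'b, 'm) module_scheme \<Rightarrow> ('a, 'c, 'n) module_scheme \<Rightarrow> ('b \<Rightarrow> 'c) set"
  where "right_module_hom R M N =
    {f \<in> carrier M \<rightarrow> carrier N.
      (\<forall>x \<in> carrier M. \<forall>y \<in> carrier M. f (x \<oplus>\<^bsub>M\<^esub> y) = f x \<oplus>\<^bsub>N\<^esub> f y) \<and>
      (\<forall>a \<in> carrier R. \<forall>x \<in> carrier M. f (a \<odot>\<^bsub>M\<^esub> x) = a \<odot>\<^bsub>N\<^esub> f x)}"

definition right_module_epi ::
    "('a, 'r) ring_scheme \<Rightarrow> ('a, 'b, 'm) module_scheme \<Rightarrow> ('a, 'c, 'n) module_scheme \<Rightarrow> ('b \<Rightarrow> 'c) set"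
  where "right_module_epi R M N = {f \<in> right_module_hom R M N. f ` carrier M = carrier N}"

text \<open>The free right module \<open>S\<^sup>k\<close>, its elements being extensional functions on \<open>{..<k}\<close>.\<close>

definition free_right_module :: "('a, 'r) ring_scheme \<Rightarrow> nat \<Rightarrow> ('a, nat \<Rightarrow> 'a) module"
  where "free_right_module S k =
    \<lparr>carrier = {..<k} \<rightarrow>\<^sub>E carrier S,
     mult = undefined,
     one = undefined,
     zero = (\<lambda>i\<in>{..<k}. \<zero>\<^bsub>S\<^esub>),
     add = (\<lambda>x y. \<lambda>i\<in>{..<k}. x i \<oplus>\<^bsub>S\<^esub> y i),
     smult = (\<lambda>a x. \<lambda>i\<in>{..<k}. x i \<otimes>\<^bsub>S\<^esub> a)\<rparr>"

lemma free_right_module_simps [simp]: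
  "carrier (free_right_module S k) = {..<k} \<rightarrow>\<^sub>E carrier S"
  "\<zero>\<^bsub>free_right_module S k\<^esub> = (\<lambda>i\<in>{..<k}. \<zero>\<^bsub>S\<^esub>)"
  "x \<oplus>\<^bsub>free_right_module S k\<^esub> y = (\<lambda>i\<in>{..<k}. x i \<oplus>\<^bsub>S\<^esub> y i)"
  "a \<odot>\<^bsub>free_right_module S k\<^esub> x = (\<lambda>i\<in>{..<k}. x i \<otimes>\<^bsub>S\<^esub> a)"
  by (simp_all add: free_right_module_def)

lemma right_module_free_right_module:
  assumes "ring S"
  shows "right_module S (free_right_module S k)"
proof -
  interpret ring S by fact
  let ?F = "free_right_module S k"
  have mem: "\<forall>i<k. x i \<in> carrier S" if "x \<in> carrier ?F" for x
    using that by (auto simp: PiE_iff)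
  have eq: "restrict f {..<k} = x"
    if "x \<in> carrier ?F" "\<forall>i<k. f i = x i" for x and f :: "nat \<Rightarrow> 'a"
    using that by (auto simp: fun_eq_iff PiE_iff extensional_def)
  have closed: "restrict f {..<k} \<in> carrier ?F"
    if "\<forall>i<k. f i \<in> carrier S" for f :: "nat \<Rightarrow> 'a"
    using that by auto
  have "abelian_group ?F"
  proof (rule abelian_groupI)
    show "\<zero>\<^bsub>?F\<^esub> \<in> carrier ?F" by simp
  next
    fix x y assume "x \<in> carrier ?F" "y \<in> carrier ?F"
    note xy = this[THEN mem]
    show "x \<oplus>\<^bsub>?F\<^esub> y \<in> carrier ?F"
      unfolding free_right_module_simps(3) using xy by (intro closed) simp
    show "x \<oplus>\<^bsub>?F\<^esub> y = y \<oplus>\<^bsub>?F\<^esub> x"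
      using xy unfolding free_right_module_simps(3) by (intro restrict_ext) (simp add: a_comm)
  next
    fix x y z assume "x \<in> carrier ?F" "y \<in> carrier ?F" "z \<in> carrier ?F"
    note xyz = this[THEN mem]
    show "(x \<oplus>\<^bsub>?F\<^esub> y) \<oplus>\<^bsub>?F\<^esub> z = x \<oplus>\<^bsub>?F\<^esub> (y \<oplus>\<^bsub>?F\<^esub> z)"
      using xyz unfolding free_right_module_simps(3) by (intro restrict_ext) (simp add: a_assoc)
  next
    fix x assume x: "x \<in> carrier ?F"
    show "\<zero>\<^bsub>?F\<^esub> \<oplus>\<^bsub>?F\<^esub> x = x"
      unfolding free_right_module_simps(2,3) using mem[OF x] by (intro eq[OF x]) simp
    show "\<exists>y\<in>carrier ?F. y \<oplus>\<^bsub>?F\<^esub> x = \<zero>\<^bsub>?F\<^esub>"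
      using mem[OF x] unfolding free_right_module_simps(2,3)
      by (intro bexI[of _ "\<lambda>i\<in>{..<k}. \<ominus>\<^bsub>S\<^esub> x i"] restrict_ext closed) (simp_all add: l_neg)
  qed
  moreover have "right_module_axioms S ?F"
  proof
    fix a x assume a: "a \<in> carrier S" and x: "x \<in> carrier ?F"
    show "a \<odot>\<^bsub>?F\<^esub> x \<in> carrier ?F"
      unfolding free_right_module_simps(4) using a mem[OF x] by (intro closed) simp
  next
    fix a b x assume a: "a \<in> carrier S" and b: "b \<in> carrier S" and x: "x \<in> carrier ?F"
    show "(a \<oplus>\<^bsub>S\<^esub> b) \<odot>\<^bsub>?F\<^esub> x = a \<odot>\<^bsub>?F\<^esub> x \<oplus>\<^bsub>?F\<^esub> b \<odot>\<^bsub>?F\<^esub> x"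
      using a b mem[OF x] unfolding free_right_module_simps(3,4)
      by (intro restrict_ext) (simp add: r_distr)
    show "(a \<otimes>\<^bsub>S\<^esub> b) \<odot>\<^bsub>?F\<^esub> x = b \<odot>\<^bsub>?F\<^esub> (a \<odot>\<^bsub>?F\<^esub> x)"
      using a b mem[OF x] unfolding free_right_module_simps(4)
      by (intro restrict_ext) (simp add: m_assoc)
  next
    fix a x y assume a: "a \<in> carrier S" and x: "x \<in> carrier ?F" and y: "y \<in> carrier ?F"
    show "a \<odot>\<^bsub>?F\<^esub> (x \<oplus>\<^bsub>?F\<^esub> y) = a \<odot>\<^bsub>?F\<^esub> x \<oplus>\<^bsub>?F\<^esub> a \<odot>\<^bsub>?F\<^esub> y"
      using a mem[OF x] mem[OF y] unfolding free_right_module_simps(3,4)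
      by (intro restrict_ext) (simp add: l_distr)
  next
    fix x assume x: "x \<in> carrier ?F"
    show "\<one>\<^bsub>S\<^esub> \<odot>\<^bsub>?F\<^esub> x = x"
      unfolding free_right_module_simps(4) using mem[OF x] by (intro eq[OF x]) simp
  qed
  ultimately show ?thesis
    by (intro right_module.intro ring_axioms)
qed

text \<open>The value \<open>\<infinity>\<close> plays the role of \<open>\<aleph>\<^sub>0\<close>.\<close>

definition gn :: "('a, 'r) ring_scheme \<Rightarrow> enat"
  where "gn S =
    (if \<exists>k>0. right_module_epi S (free_right_module S k) (free_right_module S (k + 1)) \<noteq> {}
     then enat (LEAST k. k > 0 \<and>
       right_module_epi S (free_right_module S k) (free_right_module S (k + 1)) \<noteq> {})
     else \<infinity>)"

text \<open>
  \<open>R\<close> is the internal direct sum of the additive subgroups \<open>C i\<close>: each element is, in a unique way,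
  the sum of a finitely supported family of elements \<open>c i \<in> C i\<close>.
\<close>

definition additive_direct_sum :: "('a, 'r) ring_scheme \<Rightarrow> 'i set \<Rightarrow> ('i \<Rightarrow> 'a set) \<Rightarrow> bool"
  where "additive_direct_sum R I C \<longleftrightarrow>
    (\<forall>i\<in>I. additive_subgroup (C i) R) \<and>
    (\<forall>r\<in>carrier R. \<exists>!c. c \<in> (\<Pi>\<^sub>E i\<in>I. C i) \<and> finite {i \<in> I. c i \<noteq> \<zero>\<^bsub>R\<^esub>} \<and>
      r = (\<Oplus>\<^bsub>R\<^esub>i\<in>{i \<in> I. c i \<noteq> \<zero>\<^bsub>R\<^esub>}. c i))"

locale strongly_graded_ring = ring R + G: group G
  for R (structure) and G :: "('g, 'h) monoid_scheme" and C :: "'g \<Rightarrow> 'a set" +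
  assumes direct_sum: "additive_direct_sum R (carrier G) C"
    and component_mult: "\<lbrakk> g \<in> carrier G; h \<in> carrier G \<rbrakk> \<Longrightarrow>
      generate (add_monoid R) (C g <#>\<^bsub>R\<^esub> C h) = C (g \<otimes>\<^bsub>G\<^esub> h)"

definition base_ring :: "('a, 'r) ring_scheme \<Rightarrow> ('g, 'h) monoid_scheme \<Rightarrow> ('g \<Rightarrow> 'a set) \<Rightarrow> ('a, 'r) ring_scheme"
  where "base_ring R G C = R\<lparr>carrier := C \<one>\<^bsub>G\<^esub>\<rparr>"

end

theory Submission
  imports Defs "HOL-Library.Poly_Mapping" "HOL-Library.Z2" "HOL-Library.Countable_Set"
    "HOL-Algebra.Weak_Morphisms" "HOL-Algebra.UnivPoly" "HOL-Algebra.Subrings"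
begin

text \<open>
  The proof combines two rings. Over the field with two elements, let $S_n$ be the algebra generated by
  $a_{lk}$ and $b_{kj}$, for natural numbers $l$, $k$ and $j$, subject to $\sum_{k<n} a_{lk} b_{kj} = \delta_{lj}$
  for all $l$ and $j$. For $n > 0$ it has generating number $n$. The relations give an epimorphism from
  $S_n^n$ to $S_n^{n+1}$. For the converse, solving the relations for $a_{l0} b_{0j}$ yields a rewriting
  system without overlaps, hence a basis of words and a degree. With respect to this degree, $S_n$
  satisfies Cohn's weak algorithm for fewer than $n$ terms (\<open>weak_algorithm\<close>). Therefore, a
  right invertible matrix with fewer than $n$ columns can be reduced by column operations until one of
  its entries is a unit, whose row and column split off; it follows by induction that it has no more
  rows than columns (\<open>no_right_inverse\<close>).

  The graded ring is $R = S_m[G] \times M_I(S_n)$. The group ring has its usual grading. The finite set $I$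
  has one index of degree $1$ and $n$ indices of each other degree, and the matrix unit $e_{pq}$ has degree
  $\deg(p)^{-1} \deg(q)$; this is a strong grading as every degree occurs in $I$
  (\<open>component_mult_generate\<close>). The base ring is $S_m$ times a product of matrix rings over $S_n$, one of
  which is $S_n$ itself. A unital homomorphism from one ring to another bounds the generating number of
  the former from below by that of the latter. Thus $\mathrm{gn}(R) \ge m$ by the augmentation from
  $S_m[G]$ to $S_m$, and $\mathrm{gn}(R_1) \ge n$ by the projection to $S_n$. Conversely, $R_1$ has suitable
  matrices of size $n$ as $m \le n$. Since $G$ is not trivial, $I$ has at least $n$ elements, so the rank of
  the matrix ring $M_I(S_n)$ absorbs the generating number of $S_n$: it has generating number $1$, and
  $\mathrm{gn}(R) \le m$.

  Finally, $R$ is countable, and the structure is transported to the natural numbers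
  (\<open>strongly_graded_ring_image\<close>).
\<close>

section \<open>Algebras with the relations $\sum_k a_{lk} b_{kj} = \delta_{lj}$\<close>

text \<open>The generators: \<open>Avar l k\<close> stands for $a_{lk}$ and \<open>Bvar k j\<close> for $b_{kj}$. All indices range
over the natural numbers, so the same words serve for every $S_n$. The relations of $S_n$ only
involve the letters with \<open>k < n\<close>; those with \<open>k \<ge> n\<close> are further, free generators of it.\<close>

datatype letter = Avar nat nat | Bvar nat nat

text \<open>Words are stored in reverse: the head of the list is the last letter. The word
$c_1 c_2 \cdots c_r$ is the list \<open>[c\<^sub>r, \<dots>, c\<^sub>1]\<close>, and \<open>c # w\<close> is $w$ followed by the letter $c$.\<close>

type_synonym word = "letter list"

text \<open>Elements are finitely supported functions from words to the field with two elements. Over this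
field an element is the sum of the words in its support, and signs and scalars do not appear.\<close>

type_synonym elt = "word \<Rightarrow>\<^sub>0 bit"

abbreviation keys :: "elt \<Rightarrow> word set" where "keys \<equiv> Poly_Mapping.keys"

abbreviation lookup :: "elt \<Rightarrow> word \<Rightarrow> bit" where "lookup \<equiv> Poly_Mapping.lookup"

abbreviation mon :: "word \<Rightarrow> elt" where "mon w \<equiv> Poly_Mapping.single w 1"

lemma elt_double [simp]: "(x :: elt) + x = 0"
  by (rule poly_mapping_eqI) (simp add: lookup_add)

lemma elt_double_left [simp]: "(x :: elt) + (x + y) = y"
  by (simp flip: add.assoc)

lemma elt_eq_sum: "(x :: elt) = (\<Sum>w\<in>keys x. mon w)"
proof (rule poly_mapping_eqI)
  fix v
  show "lookup x v = lookup (\<Sum>w\<in>keys x. mon w) v"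
    by (cases "v \<in> keys x") (auto simp: lookup_sum lookup_single in_keys_iff when_def)
qed

text \<open>Induction over the words of an element.\<close>

lemma elt_closed [case_names zero add mon]:
  assumes "P 0" "\<And>x y. P x \<Longrightarrow> P y \<Longrightarrow> P (x + y)" "\<And>w. w \<in> keys x \<Longrightarrow> P (mon w)"
  shows "P (x :: elt)"
proof -
  have "P (\<Sum>w\<in>K. mon w)" if "finite K" "K \<subseteq> keys x" for K
    using that by (induction K rule: finite_induct) (auto intro: assms)
  then show ?thesis using elt_eq_sum[of x] by (metis finite_keys order_refl)
qed

lemma additive_eqI:
  fixes f g :: "elt \<Rightarrow> elt"
  assumes "additive f" "additive g" "\<And>w. w \<in> keys x \<Longrightarrow> f (mon w) = g (mon w)"
  shows "f x = g x"
  by (rule elt_closed[where P = "\<lambda>x. f x = g x" and x = x])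
    (simp_all add: assms additive.zero additive.add)

text \<open>The additive extension of a function on words.\<close>

definition lin_ext :: "(word \<Rightarrow> elt) \<Rightarrow> elt \<Rightarrow> elt"
  where "lin_ext f x = (\<Sum>w\<in>keys x. f w)"

lemma lin_ext_superset:
  assumes "finite T" "keys x \<subseteq> T"
  shows "lin_ext f x = (\<Sum>w\<in>T. if lookup x w = 1 then f w else 0)"
  unfolding lin_ext_def using assms
  by (intro sum.mono_neutral_cong_left) (auto simp: in_keys_iff)

lemma additive_lin_ext: "additive (lin_ext f)"
proof
  fix x y
  let ?T = "keys x \<union> keys y"
  have "lin_ext f (x + y) = (\<Sum>w\<in>?T. if lookup (x + y) w = 1 then f w else 0)"
    by (rule lin_ext_superset) (simp_all add: keys_add)
  also have "\<dots> = (\<Sum>w\<in>?T. (if lookup x w = 1 then f w else 0) + (if lookup y w = 1 then f w else 0))"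
    by (rule sum.cong[OF refl]) (auto simp: lookup_add)
  also have "\<dots> = lin_ext f x + lin_ext f y"
    by (simp add: sum.distrib lin_ext_superset[of ?T])
  finally show "lin_ext f (x + y) = lin_ext f x + lin_ext f y" .
qed

lemmas lin_ext_add = additive.add[OF additive_lin_ext]
lemmas lin_ext_zero [simp] = additive.zero[OF additive_lin_ext]

lemma lin_ext_mon [simp]: "lin_ext f (mon w) = f w"
  by (simp add: lin_ext_def)

lemma additive_comp: "additive f \<Longrightarrow> additive g \<Longrightarrow> additive (\<lambda>x. f (g x))"
  by (simp add: additive_def)

lemma additive_id: "additive (\<lambda>x. x)"
  by (simp add: additive_def)

text \<open>Right multiplication of a word by a letter, in normal form. For \<open>n > 0\<close> the defining relations, solved for the
product with \<open>k = 0\<close>, read $a_{l0} b_{0j} = \delta_{lj} + \sum_{0<k<n} a_{lk} b_{kj}$; they are applied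
as a rewrite rule at the end of the word, and otherwise the letter is appended. No overlap of left-hand
sides occurs, so nothing further has to be rewritten.\<close>

definition letter_act :: "nat \<Rightarrow> letter \<Rightarrow> word \<Rightarrow> elt" where
  "letter_act n c w = (case (c, w) of
     (Bvar 0 j, Avar l 0 # v) \<Rightarrow> (if l = j then mon v else 0) + (\<Sum>k\<in>{1..<n}. mon (Bvar k j # Avar l k # v))
   | _ \<Rightarrow> mon (c # w))"

lemma letter_act_cancel: "letter_act n (Bvar 0 j) (Avar l 0 # v) =
    (if l = j then mon v else 0) + (\<Sum>k\<in>{1..<n}. mon (Bvar k j # Avar l k # v))"
  by (simp add: letter_act_def)

lemma letter_act_cons:
  assumes "\<And>j l v. c = Bvar 0 j \<Longrightarrow> w = Avar l 0 # v \<Longrightarrow> False"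
  shows "letter_act n c w = mon (c # w)"
  using assms unfolding letter_act_def by (auto split: list.split letter.split nat.split)

text \<open>Right multiplication of an element by a word, letter by letter.\<close>

fun word_act :: "nat \<Rightarrow> elt \<Rightarrow> word \<Rightarrow> elt" where
  "word_act n x [] = x"
| "word_act n x (c # w) = lin_ext (letter_act n c) (word_act n x w)"

text \<open>The product of $S_n$. It is defined, biadditive and associative on all elements;
the empty word is a right unit on all of them and a left unit on the reduced ones.\<close>

definition mul :: "nat \<Rightarrow> elt \<Rightarrow> elt \<Rightarrow> elt"
  where "mul n x y = lin_ext (word_act n x) y"

lemma additive_word_act: "additive (\<lambda>x. word_act n x w)"
  by (induction w) (simp_all add: additive_id additive_comp[OF additive_lin_ext])

lemma additive_mul_right: "additive (mul n x)"
  unfolding mul_def by (rule additive_lin_ext)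

lemma additive_mul_left: "additive (\<lambda>x. mul n x y)"
  by (rule additive.intro) (simp add: mul_def lin_ext_def additive.add[OF additive_word_act] sum.distrib)

lemmas mul_add_right = additive.add[OF additive_mul_right]
lemmas mul_add_left = additive.add[OF additive_mul_left]
lemmas mul_sum_right = additive.sum[OF additive_mul_right]
lemmas mul_sum_left = additive.sum[OF additive_mul_left]
lemmas mul_zero_right [simp] = additive.zero[OF additive_mul_right]
lemmas mul_zero_left [simp] = additive.zero[OF additive_mul_left]

lemma mul_mon [simp]: "mul n x (mon w) = word_act n x w"
  by (simp add: mul_def)

text \<open>Associativity for a product whose last factor is a letter. This is where the rewriting rule has to
be compatible with the product: when \<open>c\<close> completes a left-hand side, both sides agree by the rule
itself, applied to \<open>x\<close> times the remaining word.\<close>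

lemma mul_lin_ext_letter_act: "mul n x (lin_ext (letter_act n c) y) = lin_ext (letter_act n c) (mul n x y)"
proof (rule additive_eqI[where f = "\<lambda>y. mul n x (lin_ext (letter_act n c) y)" and g = "\<lambda>y. lin_ext (letter_act n c) (mul n x y)"])
  show "additive (\<lambda>y. mul n x (lin_ext (letter_act n c) y))"
    by (simp add: additive_def lin_ext_add mul_add_right)
  show "additive (\<lambda>y. lin_ext (letter_act n c) (mul n x y))"
    by (simp add: additive_def lin_ext_add mul_add_right)
next
  fix w
  show "mul n x (lin_ext (letter_act n c) (mon w)) = lin_ext (letter_act n c) (mul n x (mon w))"
  proof (cases "\<exists>j l v. c = Bvar 0 j \<and> w = Avar l 0 # v")
    case False
    then have "letter_act n c w = mon (c # w)" by (intro letter_act_cons) blast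
    then show ?thesis by simp
  next
    case True
    then obtain j l v where c: "c = Bvar 0 j" and w: "w = Avar l 0 # v" by blast
    define t where "t = word_act n x v"
    have 1: "lin_ext (letter_act n (Avar l k)) t = lin_ext (\<lambda>w. mon (Avar l k # w)) t" for k
      unfolding lin_ext_def by (intro sum.cong refl letter_act_cons) simp
    have "lin_ext (letter_act n (Bvar 0 j)) (lin_ext (\<lambda>w. mon (Avar l 0 # w)) t) =
        (if l = j then t else 0) + (\<Sum>k\<in>{1..<n}. lin_ext (letter_act n (Bvar k j)) (lin_ext (letter_act n (Avar l k)) t))"
    proof (rule additive_eqI[where f = "\<lambda>t. lin_ext (letter_act n (Bvar 0 j)) (lin_ext (\<lambda>w. mon (Avar l 0 # w)) t)" and
          g = "\<lambda>t. (if l = j then t else 0) + (\<Sum>k\<in>{1..<n}. lin_ext (letter_act n (Bvar k j)) (lin_ext (letter_act n (Avar l k)) t))"])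
      show "additive (\<lambda>t. lin_ext (letter_act n (Bvar 0 j)) (lin_ext (\<lambda>w. mon (Avar l 0 # w)) t))"
        by (simp add: additive_def lin_ext_add)
      show "additive (\<lambda>t. (if l = j then t else 0) +
          (\<Sum>k\<in>{1..<n}. lin_ext (letter_act n (Bvar k j)) (lin_ext (letter_act n (Avar l k)) t)))"
        by (auto simp: additive_def lin_ext_add sum.distrib ac_simps)
    next
      fix u
      have "letter_act n (Avar l k) u = mon (Avar l k # u)" for k by (rule letter_act_cons) simp
      moreover have "letter_act n (Bvar k j) (Avar l k # u) = mon (Bvar k j # Avar l k # u)" if "k \<in> {1..<n}" for k
        using that by (intro letter_act_cons) simp
      ultimately show "lin_ext (letter_act n (Bvar 0 j)) (lin_ext (\<lambda>w. mon (Avar l 0 # w)) (mon u)) =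
          (if l = j then mon u else 0) + (\<Sum>k\<in>{1..<n}. lin_ext (letter_act n (Bvar k j)) (lin_ext (letter_act n (Avar l k)) (mon u)))"
        by (simp add: letter_act_cancel)
    qed
    then show ?thesis
      by (simp add: c w letter_act_cancel 1[unfolded t_def] mul_add_right mul_sum_right t_def)
  qed
qed

lemma mul_word_act: "mul n x (word_act n y w) = word_act n (mul n x y) w"
  by (induction w) (simp_all add: mul_lin_ext_letter_act)

lemma mul_assoc: "mul n (mul n x y) z = mul n x (mul n y z)"
  by (rule additive_eqI[where f = "mul n (mul n x y)" and g = "\<lambda>z. mul n x (mul n y z)"])
    (simp_all add: additive_def mul_add_right mul_word_act)

lemma mul_one_right [simp]: "mul n x (mon []) = x"
  by simp

text \<open>Words without a factor $a_{l0} b_{0j}$ (the list order is reversed). They form a basis of $S_n$.\<close>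

fun reduced_word :: "word \<Rightarrow> bool" where
  "reduced_word (Bvar 0 j # Avar l 0 # w) = False"
| "reduced_word (c # w) = reduced_word w"
| "reduced_word [] = True"

text \<open>Elements supported on reduced words.\<close>

definition reduced :: "elt \<Rightarrow> bool" where "reduced x \<longleftrightarrow> (\<forall>w\<in>keys x. reduced_word w)"

lemma reduced_word_Cons: "reduced_word (c # w) \<longleftrightarrow> reduced_word w \<and> (\<forall>j l v. c = Bvar 0 j \<longrightarrow> w \<noteq> Avar l 0 # v)"
  by (cases "(c # w)" rule: reduced_word.cases) auto

lemma reduced_0 [simp]: "reduced 0" and reduced_add: "reduced x \<Longrightarrow> reduced y \<Longrightarrow> reduced (x + y)"
  and reduced_mon [simp]: "reduced (mon w) \<longleftrightarrow> reduced_word w"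
  unfolding reduced_def using keys_add[of x y] by auto

lemma reduced_sum: "(\<And>i. i \<in> I \<Longrightarrow> reduced (f i)) \<Longrightarrow> reduced (\<Sum>i\<in>I. f i)"
  by (induction I rule: infinite_finite_induct) (auto intro: reduced_add)

lemma reduced_lin_ext: "reduced x \<Longrightarrow> (\<And>w. reduced_word w \<Longrightarrow> reduced (f w)) \<Longrightarrow> reduced (lin_ext f x)"
  unfolding lin_ext_def by (rule reduced_sum) (auto simp: reduced_def[of x])

lemma reduced_letter_act: assumes "reduced_word w" shows "reduced (letter_act n c w)"
proof (cases "\<exists>j l v. c = Bvar 0 j \<and> w = Avar l 0 # v")
  case False
  then have "letter_act n c w = mon (c # w)" by (intro letter_act_cons) blast
  with False assms show ?thesis by (auto simp: reduced_word_Cons)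
next
  case True
  then show ?thesis using assms by (auto simp: letter_act_cancel reduced_word_Cons intro!: reduced_add reduced_sum)
qed

lemma reduced_word_act: "reduced x \<Longrightarrow> reduced (word_act n x w)"
  by (induction w) (simp_all add: reduced_lin_ext reduced_letter_act)

lemma reduced_mul: "reduced x \<Longrightarrow> reduced (mul n x y)"
  unfolding mul_def lin_ext_def by (intro reduced_sum reduced_word_act)

lemma word_act_one: "reduced_word w \<Longrightarrow> word_act n (mon []) w = mon w"
proof (induction w)
  case (Cons c w)
  then have "word_act n (mon []) w = mon w" by (simp add: reduced_word_Cons)
  moreover have "letter_act n c w = mon (c # w)"
    using Cons.prems by (intro letter_act_cons) (auto simp: reduced_word_Cons)
  ultimately show ?case by simp
qed simp

lemma mul_one_left: "reduced x \<Longrightarrow> mul n (mon []) x = x"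
  by (rule additive_eqI[where f = "mul n (mon [])" and g = "\<lambda>x. x"])
    (simp_all add: additive_mul_right additive_id reduced_def word_act_one)

lemma mul_relation:
  assumes "n > 0"
  shows "(\<Sum>k<n. mul n (mon [Avar l k]) (mon [Bvar k j])) = (if l = j then mon [] else 0)"
proof -
  have *: "letter_act n (Bvar k j) [Avar l k] = mon [Bvar k j, Avar l k]" if "k \<noteq> 0" for k
    using that by (intro letter_act_cons) auto
  have "{..<n} = insert 0 {1..<n}" using assms by auto
  then have "(\<Sum>k<n. mul n (mon [Avar l k]) (mon [Bvar k j])) =
      letter_act n (Bvar 0 j) [Avar l 0] + (\<Sum>k\<in>{1..<n}. letter_act n (Bvar k j) [Avar l k])"
    by simp
  also have "(\<Sum>k\<in>{1..<n}. letter_act n (Bvar k j) [Avar l k]) = (\<Sum>k\<in>{1..<n}. mon [Bvar k j, Avar l k])"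
    by (rule sum.cong) (simp_all add: *)
  finally show ?thesis by (simp add: letter_act_cancel add.assoc)
qed

section \<open>Degrees and leading terms of products\<close>

text \<open>Degree at most \<open>d\<close>, by the length of words. The bound is an integer so that a negative bound
singles out zero.\<close>

definition degree_le :: "int \<Rightarrow> elt \<Rightarrow> bool"
  where "degree_le d x \<longleftrightarrow> (\<forall>w\<in>keys x. int (length w) \<le> d)"

lemma degree_le_0 [simp]: "degree_le d 0" and degree_le_mon [simp]: "degree_le d (mon w) \<longleftrightarrow> int (length w) \<le> d"
  by (simp_all add: degree_le_def)

lemma degree_le_add: "degree_le d x \<Longrightarrow> degree_le d y \<Longrightarrow> degree_le d (x + y)"
  unfolding degree_le_def using keys_add[of x y] by auto

lemma degree_le_sum: "(\<And>i. i \<in> I \<Longrightarrow> degree_le d (f i)) \<Longrightarrow> degree_le d (\<Sum>i\<in>I. f i)"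
  by (induction I rule: infinite_finite_induct) (auto intro: degree_le_add)

lemma degree_le_mono: "degree_le d x \<Longrightarrow> d \<le> e \<Longrightarrow> degree_le e x"
  unfolding degree_le_def by force

lemma degree_le_neg: "degree_le d x \<Longrightarrow> d < 0 \<Longrightarrow> x = 0"
  unfolding degree_le_def by (rule ccontr) (auto simp flip: keys_eq_empty)

lemma degree_le_cancel: "degree_le d (x + y) \<Longrightarrow> degree_le d x \<Longrightarrow> degree_le d y"
  by (metis degree_le_add elt_double_left)

lemma degree_le_lin_ext: "(\<And>w. w \<in> keys x \<Longrightarrow> degree_le e (f w)) \<Longrightarrow> degree_le e (lin_ext f x)"
  unfolding lin_ext_def by (rule degree_le_sum)

lemma degree_le_0_const: assumes "degree_le 0 x" "x \<noteq> 0" shows "x = mon []"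
proof -
  have "keys x \<subseteq> {[]}" using assms(1) by (auto simp: degree_le_def)
  moreover have "keys x \<noteq> {}" using assms(2) by simp
  ultimately have "keys x = {[]}" by blast
  then show ?thesis using elt_eq_sum[of x] by simp
qed

lemma degree_le_ex: "\<exists>e::nat. degree_le (int e - 1) x"
proof -
  obtain b where "\<forall>m\<in>length ` keys x. m \<le> b"
    using finite_nat_set_iff_bounded_le[of "length ` keys x"] by auto
  then have "degree_le (int (Suc b) - 1) x" by (auto simp: degree_le_def)
  then show ?thesis ..
qed

lemma letter_act_cases:
  obtains (cons) "letter_act n c w = mon (c # w)" "\<And>j l v. c = Bvar 0 j \<Longrightarrow> w \<noteq> Avar l 0 # v"
  | (cancel) j l v where "c = Bvar 0 j" "w = Avar l 0 # v"
    "letter_act n c w = (if l = j then mon v else 0) + (\<Sum>k\<in>{1..<n}. mon (Bvar k j # Avar l k # v))"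
proof (cases "\<exists>j l v. c = Bvar 0 j \<and> w = Avar l 0 # v")
  case True
  then show ?thesis using cancel letter_act_cancel by blast
next
  case False
  then show ?thesis using cons letter_act_cons[of c w n] by blast
qed

lemma degree_le_letter_act: "degree_le (int (length w) + 1) (letter_act n c w)"
  by (cases n c w rule: letter_act_cases) (auto intro!: degree_le_add degree_le_sum)

lemma degree_le_lin_ext_letter_act: "degree_le d u \<Longrightarrow> degree_le (d + 1) (lin_ext (letter_act n c) u)"
  by (rule degree_le_lin_ext, rule degree_le_mono[OF degree_le_letter_act]) (auto simp: degree_le_def)

lemma degree_le_word_act: "degree_le d x \<Longrightarrow> degree_le (d + int (length w)) (word_act n x w)"
proof (induction w)
  case (Cons c w)
  then show ?case using degree_le_lin_ext_letter_act[of "d + int (length w)" "word_act n x w" n c]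
    by (simp add: algebra_simps)
qed simp

text \<open>The left cofactor of a last letter: every element is its constant term plus the sum of its
cofactors followed by the respective letters.\<close>

definition cofactor :: "letter \<Rightarrow> elt \<Rightarrow> elt"
  where "cofactor c = lin_ext (\<lambda>w. case w of [] \<Rightarrow> 0 | c' # v \<Rightarrow> if c' = c then mon v else 0)"

text \<open>With $u = u' + \sum_{l,k} z_{lk} a_{lk}$, where no word of $u'$ ends in a letter $a_{lk}$, the element
\<open>reindex a b u\<close> is $\sum_l z_{la} a_{lb}$. This passes between the components of a vector
$(\sum_l z_l a_{lk})_k$ without naming the coefficients $z_l$.\<close>

definition reindex :: "nat \<Rightarrow> nat \<Rightarrow> elt \<Rightarrow> elt"
  where "reindex a b = lin_ext (\<lambda>w. case w of Avar l k # v \<Rightarrow> if k = a then mon (Avar l b # v) else 0 | _ \<Rightarrow> 0)"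

lemma additive_cofactor: "additive (cofactor c)" and additive_reindex: "additive (reindex a b)"
  by (simp_all add: cofactor_def reindex_def additive_lin_ext)

lemmas cofactor_simps [simp] = additive.zero[OF additive_cofactor] additive.add[OF additive_cofactor] additive.sum[OF additive_cofactor]
lemmas reindex_simps [simp] = additive.zero[OF additive_reindex] additive.add[OF additive_reindex] additive.sum[OF additive_reindex]

lemma cofactor_mon [simp]: "cofactor c (mon []) = 0" "cofactor c (mon (c' # v)) = (if c' = c then mon v else 0)"
  by (simp_all add: cofactor_def)

lemma reindex_mon [simp]: "reindex a b (mon []) = 0"
  "reindex a b (mon (Avar l k # v)) = (if k = a then mon (Avar l b # v) else 0)"
  "reindex a b (mon (Bvar k j # v)) = 0"
  by (simp_all add: reindex_def)

lemma lookup_cofactor: "lookup (cofactor c u) w = lookup u (c # w)"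
proof (rule elt_closed[where P = "\<lambda>u. lookup (cofactor c u) w = lookup u (c # w)" and x = u])
  fix v show "lookup (cofactor c (mon v)) w = lookup (mon v) (c # w)"
    by (cases v) (auto simp: lookup_single when_def)
qed (simp_all add: lookup_add)

lemma keys_cofactor: "keys (cofactor c u) = {w. c # w \<in> keys u}"
  by (auto simp: in_keys_iff lookup_cofactor)

lemma degree_le_cofactor: "degree_le d u \<Longrightarrow> degree_le (d - 1) (cofactor c u)"
  by (force simp: degree_le_def keys_cofactor)

lemma reduced_cofactor: "reduced u \<Longrightarrow> reduced (cofactor c u)"
  by (force simp: reduced_def keys_cofactor reduced_word_Cons)

lemma degree_le_from_cofactor:
  assumes "\<And>c. degree_le (e - 1) (cofactor c y)" "0 \<le> e"
  shows "degree_le e y"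
  unfolding degree_le_def
proof
  fix w assume w: "w \<in> keys y"
  show "int (length w) \<le> e"
  proof (cases w)
    case (Cons c v)
    then have "v \<in> keys (cofactor c y)" using w by (simp add: keys_cofactor)
    then show ?thesis using assms(1)[of c] Cons by (auto simp: degree_le_def)
  qed (use assms(2) in simp)
qed

lemma degree_le_reindex: "degree_le d u \<Longrightarrow> degree_le d (reindex a b u)"
  unfolding reindex_def by (rule degree_le_lin_ext) (auto simp: degree_le_def split: list.split letter.split)

lemma reduced_reindex: "reduced u \<Longrightarrow> reduced (reindex a b u)"
  unfolding reindex_def by (rule reduced_lin_ext) (auto simp: reduced_word_Cons split: list.split letter.split)

lemma reindex_reindex: "reindex a b (reindex c d u) = (if d = a then reindex c b u else 0)"
proof (rule elt_closed[where P = "\<lambda>u. reindex a b (reindex c d u) = (if d = a then reindex c b u else 0)" and x = u])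
  fix w show "reindex a b (reindex c d (mon w)) = (if d = a then reindex c b (mon w) else 0)"
    by (cases w rule: list.exhaust[case_product letter.exhaust[of "hd w"]]) auto
qed auto

lemma reindex_cofactor_reduced:
  assumes "reduced y"
  shows "reindex 0 b (cofactor (Bvar 0 j) y) = 0"
proof -
  have *: "(case w of Avar l k # v \<Rightarrow> if k = 0 then mon (Avar l b # v) else 0 | _ \<Rightarrow> 0) = 0"
    if "w \<in> keys (cofactor (Bvar 0 j) y)" for w
    using that assms by (force simp: keys_cofactor reduced_def reduced_word_Cons split: list.split letter.split)
  show ?thesis unfolding reindex_def lin_ext_def by (rule sum.neutral) (use * in blast)
qed

text \<open>Taking the cofactor of a letter that occurs in no relation on the right commutes with
multiplication by a letter, up to terms of lower degree. The next two lemmas are the analogues for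
$b_{kj}$ with \<open>k < n\<close> and for \<open>reindex\<close>. In each, the sum of two elements stands for their difference.\<close>

lemma cofactor_letter_act:
  assumes "n > 0" "\<And>k j. k < n \<Longrightarrow> c0 \<noteq> Bvar k j" "degree_le f u"
  shows "degree_le (f - 1) (cofactor c0 (lin_ext (letter_act n c) u) + (if c = c0 then u else 0))"
proof (rule elt_closed[where x = u])
  fix x y assume "degree_le (f - 1) (cofactor c0 (lin_ext (letter_act n c) x) + (if c = c0 then x else 0))"
    "degree_le (f - 1) (cofactor c0 (lin_ext (letter_act n c) y) + (if c = c0 then y else 0))"
  from degree_le_add[OF this]
  show "degree_le (f - 1) (cofactor c0 (lin_ext (letter_act n c) (x + y)) + (if c = c0 then x + y else 0))"
    by (simp add: lin_ext_add ac_simps split: if_splits)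
next
  fix w assume "w \<in> keys u"
  then have w: "int (length w) \<le> f" using assms(3) by (auto simp: degree_le_def)
  show "degree_le (f - 1) (cofactor c0 (lin_ext (letter_act n c) (mon w)) + (if c = c0 then mon w else 0))"
  proof (cases n c w rule: letter_act_cases)
    case cons
    then show ?thesis by simp
  next
    case (cancel j l v)
    have "degree_le (f - 1) (cofactor c0 (mon v))"
      using degree_le_cofactor[of "int (length v)" "mon v" c0] w cancel(2) by (auto intro: degree_le_mono)
    moreover have "Bvar k j \<noteq> c0" if "k < n" for k
      using assms(2)[OF that, of j] by simp
    then have "cofactor c0 (\<Sum>k\<in>{1..<n}. mon (Bvar k j # Avar l k # v)) = 0"
      by (auto intro!: sum.neutral)
    moreover have "c \<noteq> c0" using assms(1,2) cancel(1) by blast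
    ultimately show ?thesis using cancel(3) by auto
  qed
qed simp

text \<open>The rewriting rule moves the part of $u$ ending in $a_{l0}$ from the letter $b_{0j}$ to the letters
$b_{kj}$. For \<open>k = 0\<close> the two correction terms together are the part of $u$ that does not end in
some $a_{l0}$.\<close>

lemma cofactor_letter_act_B:
  assumes "k < n" "degree_le f u"
  shows "degree_le (f - 1) (cofactor (Bvar k j) (lin_ext (letter_act n c) u) +
    ((if c = Bvar k j then u else 0) + (if c = Bvar 0 j then reindex 0 k u else 0)))"
proof (rule elt_closed[where x = u])
  fix x y assume "degree_le (f - 1) (cofactor (Bvar k j) (lin_ext (letter_act n c) x) +
       ((if c = Bvar k j then x else 0) + (if c = Bvar 0 j then reindex 0 k x else 0)))"
     "degree_le (f - 1) (cofactor (Bvar k j) (lin_ext (letter_act n c) y) +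
       ((if c = Bvar k j then y else 0) + (if c = Bvar 0 j then reindex 0 k y else 0)))"
  from degree_le_add[OF this]
  show "degree_le (f - 1) (cofactor (Bvar k j) (lin_ext (letter_act n c) (x + y)) +
       ((if c = Bvar k j then x + y else 0) + (if c = Bvar 0 j then reindex 0 k (x + y) else 0)))"
    by (cases "c = Bvar k j"; cases "c = Bvar 0 j") (simp_all add: lin_ext_add ac_simps)
next
  fix w assume "w \<in> keys u"
  then have w: "int (length w) \<le> f" using assms(2) by (auto simp: degree_le_def)
  show "degree_le (f - 1) (cofactor (Bvar k j) (lin_ext (letter_act n c) (mon w)) +
     ((if c = Bvar k j then mon w else 0) + (if c = Bvar 0 j then reindex 0 k (mon w) else 0)))"
  proof (cases n c w rule: letter_act_cases)
    case cons
    have "reindex 0 k (mon w) = 0" if "c = Bvar 0 j"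
      using cons(2)[OF that] by (cases w rule: list.exhaust[case_product letter.exhaust[of "hd w"]]) auto
    then show ?thesis using cons(1) by auto
  next
    case (cancel j' l v)
    have "degree_le (f - 1) (cofactor (Bvar k j) (mon v))"
      using degree_le_cofactor[of "int (length v)" "mon v" "Bvar k j"] w cancel(2) by (auto intro: degree_le_mono)
    moreover have "cofactor (Bvar k j) (\<Sum>k\<in>{1..<n}. mon (Bvar k j' # Avar l k # v)) =
        (if j' = j \<and> k \<noteq> 0 then mon (Avar l k # v) else 0)"
      using assms(1) by (auto simp: if_distrib[of cofactor] cong: if_cong)
    ultimately show ?thesis using cancel by (auto simp: add.assoc)
  qed
qed simp

lemma reindex_letter_act:
  assumes "degree_le f u"
  shows "degree_le f (reindex a b (lin_ext (letter_act n c) u) +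
    (case c of Avar l k \<Rightarrow> if k = a then lin_ext (letter_act n (Avar l b)) u else 0 | Bvar k j \<Rightarrow> 0))"
proof (rule elt_closed[where x = u])
  fix x y assume "degree_le f (reindex a b (lin_ext (letter_act n c) x) +
      (case c of Avar l k \<Rightarrow> if k = a then lin_ext (letter_act n (Avar l b)) x else 0 | Bvar k j \<Rightarrow> 0))"
    "degree_le f (reindex a b (lin_ext (letter_act n c) y) +
      (case c of Avar l k \<Rightarrow> if k = a then lin_ext (letter_act n (Avar l b)) y else 0 | Bvar k j \<Rightarrow> 0))"
  from degree_le_add[OF this]
  show "degree_le f (reindex a b (lin_ext (letter_act n c) (x + y)) +
      (case c of Avar l k \<Rightarrow> if k = a then lin_ext (letter_act n (Avar l b)) (x + y) else 0 | Bvar k j \<Rightarrow> 0))"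
    by (simp add: lin_ext_add ac_simps split: if_splits letter.splits)
next
  fix w assume "w \<in> keys u"
  then have w: "int (length w) \<le> f" using assms by (auto simp: degree_le_def)
  show "degree_le f (reindex a b (lin_ext (letter_act n c) (mon w)) +
      (case c of Avar l k \<Rightarrow> if k = a then lin_ext (letter_act n (Avar l b)) (mon w) else 0 | Bvar k j \<Rightarrow> 0))"
  proof (cases n c w rule: letter_act_cases)
    case cons
    have "letter_act n (Avar l b) w = mon (Avar l b # w)" for l by (rule letter_act_cons) simp
    then show ?thesis using cons(1) by (auto split: letter.split)
  next
    case (cancel j l v)
    then show ?thesis using w degree_le_reindex[of "int (length v)" "mon v" a b] by (auto intro: degree_le_mono)
  qed
qed (auto split: letter.split)

text \<open>Extends a statement on multiplication by a last letter to products \<open>mul n x y\<close>. A constant term of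
\<open>y\<close> contributes only terms of lower degree if \<open>e > 0\<close>; for \<open>e = 0\<close> it has to be excluded.\<close>

lemma mul_induct:
  assumes "degree_le d x" "degree_le e y" "e \<noteq> 0 \<or> y = 0"
    "additive F" "additive G"
    "e \<ge> 1 \<Longrightarrow> degree_le (d + e - r) (F x)" "G (mon []) = 0"
    "\<And>c w. int (length w) \<le> e - 1 \<Longrightarrow> degree_le (d + e - 1) (word_act n x w) \<Longrightarrow>
       degree_le (d + e - r) (F (lin_ext (letter_act n c) (word_act n x w)) + G (mon (c # w)))"
  shows "degree_le (d + e - r) (F (mul n x y) + G y)"
proof (rule elt_closed[where x = y])
  fix u v assume "degree_le (d + e - r) (F (mul n x u) + G u)" "degree_le (d + e - r) (F (mul n x v) + G v)"
  from degree_le_add[OF this] show "degree_le (d + e - r) (F (mul n x (u + v)) + G (u + v))"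
    by (simp add: mul_add_right additive.add[OF assms(4)] additive.add[OF assms(5)] ac_simps)
next
  fix w assume "w \<in> keys y"
  then have w: "int (length w) \<le> e" using assms(2) by (auto simp: degree_le_def)
  show "degree_le (d + e - r) (F (mul n x (mon w)) + G (mon w))"
  proof (cases w)
    case Nil
    have "e \<ge> 1" using w \<open>w \<in> keys y\<close> assms(3) by fastforce
    then show ?thesis using assms(6,7) Nil by simp
  next
    case (Cons c v)
    have v: "int (length v) \<le> e - 1" using w Cons by simp
    have "degree_le (d + e - 1) (word_act n x v)"
      by (rule degree_le_mono[OF degree_le_word_act[OF assms(1)]]) (use v in simp)
    then show ?thesis using assms(8)[OF v] Cons by simp
  qed
qed (simp add: additive.zero[OF assms(4)] additive.zero[OF assms(5)])

lemma cofactor_mul: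
  assumes "n > 0" "\<And>k j. k < n \<Longrightarrow> c0 \<noteq> Bvar k j" "degree_le d x" "degree_le e y" "e \<noteq> 0 \<or> y = 0"
  shows "degree_le (d + e - 2) (cofactor c0 (mul n x y) + mul n x (cofactor c0 y))"
proof (rule mul_induct[OF assms(3-5)])
  show "additive (cofactor c0)" "additive (\<lambda>y. mul n x (cofactor c0 y))"
    by (simp_all add: additive_def mul_add_right)
  show "degree_le (d + e - 2) (cofactor c0 x)" if "e \<ge> 1"
    by (rule degree_le_mono[OF degree_le_cofactor[OF assms(3)]]) (use that in simp)
next
  fix c w assume "degree_le (d + e - 1) (word_act n x w)"
  from cofactor_letter_act[OF assms(1,2) this, of c]
  show "degree_le (d + e - 2) (cofactor c0 (lin_ext (letter_act n c) (word_act n x w)) + mul n x (cofactor c0 (mon (c # w))))"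
    by (auto split: if_splits)
qed simp

lemma cofactor_mul_B:
  assumes "k < n" "degree_le d x" "degree_le e y" "e \<noteq> 0 \<or> y = 0"
  shows "degree_le (d + e - 2) (cofactor (Bvar k j) (mul n x y) +
    (mul n x (cofactor (Bvar k j) y) + reindex 0 k (mul n x (cofactor (Bvar 0 j) y))))"
proof (rule mul_induct[OF assms(2-4)])
  show "additive (cofactor (Bvar k j))"
    "additive (\<lambda>y. mul n x (cofactor (Bvar k j) y) + reindex 0 k (mul n x (cofactor (Bvar 0 j) y)))"
    by (simp_all add: additive_def mul_add_right ac_simps)
  show "degree_le (d + e - 2) (cofactor (Bvar k j) x)" if "e \<ge> 1"
    by (rule degree_le_mono[OF degree_le_cofactor[OF assms(2)]]) (use that in simp)
next
  fix c w assume "degree_le (d + e - 1) (word_act n x w)"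
  from cofactor_letter_act_B[OF assms(1) this, of j c]
  show "degree_le (d + e - 2) (cofactor (Bvar k j) (lin_ext (letter_act n c) (word_act n x w)) +
     (mul n x (cofactor (Bvar k j) (mon (c # w))) + reindex 0 k (mul n x (cofactor (Bvar 0 j) (mon (c # w))))))"
    by (cases "c = Bvar k j"; cases "c = Bvar 0 j") (auto split: if_splits)
qed simp

lemma reindex_mul:
  assumes "degree_le d x" "degree_le e y" "e \<noteq> 0 \<or> y = 0"
  shows "degree_le (d + e - 1) (reindex a b (mul n x y) + mul n x (reindex a b y))"
proof (rule mul_induct[OF assms])
  show "additive (reindex a b)" "additive (\<lambda>y. mul n x (reindex a b y))"
    by (simp_all add: additive_def mul_add_right)
  show "degree_le (d + e - 1) (reindex a b x)" if "e \<ge> 1"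
    by (rule degree_le_mono[OF degree_le_reindex[OF assms(1)]]) (use that in simp)
next
  fix c w assume "degree_le (d + e - 1) (word_act n x w)"
  from reindex_letter_act[OF this, of a b n c]
  show "degree_le (d + e - 1) (reindex a b (lin_ext (letter_act n c) (word_act n x w)) + mul n x (reindex a b (mon (c # w))))"
    by (cases c) (auto split: if_splits)
qed simp

section \<open>The weak algorithm\<close>

text \<open>Fewer than \<open>n\<close> homogeneous linear equations over the field with two elements have a nonzero
solution in \<open>n\<close> unknowns; a solution is given as the set \<open>C\<close> of unknowns with value one.\<close>

lemma bit_kernel:
  fixes v :: "'i \<Rightarrow> nat \<Rightarrow> bit"
  assumes "finite I" "card I < n"
  shows "\<exists>C\<subseteq>{..<n}. C \<noteq> {} \<and> (\<forall>i\<in>I. (\<Sum>k\<in>C. v i k) = 0)"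
proof -
  define f where "f C = {i\<in>I. (\<Sum>k\<in>C. v i k) = 1}" for C
  have "\<not> inj_on f (Pow {..<n})"
  proof
    assume "inj_on f (Pow {..<n})"
    moreover have "f ` Pow {..<n} \<subseteq> Pow I" by (auto simp: f_def)
    ultimately have "card (Pow {..<n}) \<le> card (Pow I)"
      by (rule card_inj_on_le) (use assms in simp)
    then show False using assms by (simp add: card_Pow)
  qed
  then obtain C D where CD: "C \<subseteq> {..<n}" "D \<subseteq> {..<n}" "f C = f D" "C \<noteq> D"
    by (auto simp: inj_on_def)
  then have fin: "finite C" "finite D" by (auto intro: finite_subset)
  have "(\<Sum>k\<in>(C - D) \<union> (D - C). v i k) = 0" if "i \<in> I" for i
  proof -
    have "(\<Sum>k\<in>C. v i k) = (\<Sum>k\<in>D. v i k)"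
    proof -
      have "i \<in> f C \<longleftrightarrow> i \<in> f D" using CD(3) by simp
      then show ?thesis using that
        by (cases "\<Sum>k\<in>C. v i k"; cases "\<Sum>k\<in>D. v i k") (auto simp: f_def)
    qed
    moreover have "(\<Sum>k\<in>C. v i k) = (\<Sum>k\<in>C - D. v i k) + (\<Sum>k\<in>C \<inter> D. v i k)"
      "(\<Sum>k\<in>D. v i k) = (\<Sum>k\<in>D - C. v i k) + (\<Sum>k\<in>C \<inter> D. v i k)"
      using sum.Int_Diff[OF fin(1), of "v i" D] sum.Int_Diff[OF fin(2), of "v i" C]
      by (simp_all only: add.commute Int_commute)
    ultimately have "(\<Sum>k\<in>C - D. v i k) = (\<Sum>k\<in>D - C. v i k)"
      by (metis add_right_cancel)
    then show ?thesis using fin by (subst sum.union_disjoint) auto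
  qed
  then show ?thesis using CD by (intro exI[of _ "(C - D) \<union> (D - C)"]) auto
qed

text \<open>Some \<open>x i\<close> agrees, up to terms of degree less than \<open>d i\<close>, with a right linear combination of the
other \<open>x j\<close> in which no product exceeds degree \<open>d i\<close>. Here \<open>d i\<close> is an upper bound for the degree
of \<open>x i\<close>, not necessarily the degree.\<close>

definition right_dependent :: "nat \<Rightarrow> 'i set \<Rightarrow> ('i \<Rightarrow> int) \<Rightarrow> ('i \<Rightarrow> elt) \<Rightarrow> bool" where
  "right_dependent n J d x \<longleftrightarrow> (\<exists>i\<in>J. \<exists>c. (\<forall>j\<in>J - {i}. reduced (c j) \<and> degree_le (d i - d j) (c j)) \<and>
     degree_le (d i - 1) (x i + (\<Sum>j\<in>J - {i}. mul n (x j) (c j))))"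

text \<open>The inductive step, on \<open>D\<close>, of the weak algorithm below. The cofactors of all \<open>y i\<close> are shown to
be of lower degree than expected. For a letter $b_{kj}$ with \<open>k < n\<close>, let $z_{ki}$ be the cofactor of
$b_{kj}$ in $y_i$. The rewriting rule gives $\sum_i x_i z_{ki} \equiv \sum_l t_l a_{lk}$ for all
\<open>k < n\<close>, with the same $t_l$ for all $k$. The coefficients $z_{ki}$ are constants for at most \<open>card J < n\<close> indices \<open>i\<close>, so in the sum of these
equations over a suitable nonempty set of \<open>k\<close> the constant coefficients vanish.
Comparing the parts ending in a letter $a$ expresses the $t_l$ through the $x_i$, and subtracting
yields relations of smaller degree, one for each $k$. By induction, $z_{ki} \equiv \sum_l w_{il} a_{lk}$
with $w_{il}$ independent of $k$. As $y_i$ is reduced, no word of $z_{0i}$ ends in some $a_{l0}$. Hence the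
leading terms of the $w_{il}$ vanish, and with them those of $z_{ki}$.\<close>

lemma weak_algorithm_step:
  fixes D :: int
  assumes J: "finite J" "card J < n"
    and x: "\<And>i. i \<in> J \<Longrightarrow> 0 \<le> d i" "\<And>i. i \<in> J \<Longrightarrow> degree_le (d i) (x i)"
    and indep: "\<not> right_dependent n J d x"
    and IH: "\<And>y. (\<And>i. i \<in> J \<Longrightarrow> reduced (y i)) \<Longrightarrow> (\<And>i. i \<in> J \<Longrightarrow> degree_le (D - 1 - d i) (y i)) \<Longrightarrow>
       degree_le (D - 2) (\<Sum>i\<in>J. mul n (x i) (y i)) \<Longrightarrow> (\<And>i. i \<in> J \<Longrightarrow> degree_le (D - 2 - d i) (y i))"
    and y: "\<And>i. i \<in> J \<Longrightarrow> reduced (y i)" "\<And>i. i \<in> J \<Longrightarrow> degree_le (D - d i) (y i)"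
    and rel: "degree_le (D - 1) (\<Sum>i\<in>J. mul n (x i) (y i))"
    and iJ: "i \<in> J"
  shows "degree_le (D - 1 - d i) (y i)"
proof -
  have n: "n > 0" using J by simp
  \<comment> \<open>If \<open>d i = D\<close>, a nonzero \<open>y i\<close> is the unit and expresses the leading part of \<open>x i\<close> through the others.\<close>
  have nonconst: "D - d i \<noteq> 0 \<or> y i = 0" if i: "i \<in> J" for i
  proof (rule ccontr)
    assume "\<not> ?thesis"
    then have D: "d i = D" and "y i \<noteq> 0" by auto
    then have "y i = mon []" using y(2)[OF i] by (intro degree_le_0_const) auto
    then have "degree_le (d i - 1) (x i + (\<Sum>j\<in>J - {i}. mul n (x j) (y j)))"
      using rel sum.remove[OF J(1) i, of "\<lambda>i. mul n (x i) (y i)"] D by simp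
    then have "right_dependent n J d x"
      unfolding right_dependent_def using i y D by (intro bexI[of _ i] exI[of _ y]) auto
    then show False using indep by blast
  qed
  have sumrel: "degree_le (D - 2) (\<Sum>i\<in>J. G i)"
    if "\<And>i. i \<in> J \<Longrightarrow> degree_le (D - 2) (F i + G i)" "degree_le (D - 2) (\<Sum>i\<in>J. F i)" for F G :: "_ \<Rightarrow> elt"
  proof -
    have "degree_le (D - 2) (\<Sum>i\<in>J. F i + G i)"
      by (rule degree_le_sum) (rule that(1))
    then have "degree_le (D - 2) ((\<Sum>i\<in>J. F i) + (\<Sum>i\<in>J. G i))"
      by (simp only: sum.distrib)
    then show ?thesis by (rule degree_le_cancel) (rule that(2))
  qed
  have rel': "degree_le (D - 2) (\<Sum>i\<in>J. cofactor c (mul n (x i) (y i)))" for c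
    using degree_le_cofactor[OF rel, of c] by simp
  have cofactor_low: "degree_le (D - 2 - d i) (cofactor c (y i))" if i: "i \<in> J" for i c
  proof (cases "\<exists>k j. k < n \<and> c = Bvar k j")
    case False
    have "degree_le (D - 2) (\<Sum>i\<in>J. mul n (x i) (cofactor c (y i)))"
    proof (rule sumrel[OF _ rel'[of c]])
      fix i assume "i \<in> J"
      from cofactor_mul[OF n _ x(2)[OF this] y(2)[OF this] nonconst[OF this], of c]
      show "degree_le (D - 2) (cofactor c (mul n (x i) (y i)) + mul n (x i) (cofactor c (y i)))"
        using False by auto
    qed
    moreover have "degree_le (D - 1 - d i) (cofactor c (y i))" if "i \<in> J" for i
      using degree_le_cofactor[OF y(2)[OF that], of c] by (simp add: algebra_simps)
    ultimately show ?thesis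
      using IH[of "\<lambda>i. cofactor c (y i)" i] i y(1) reduced_cofactor by blast
  next
    case True
    then obtain k j where k: "k < n" and c: "c = Bvar k j" by blast
    define z where "z k i = cofactor (Bvar k j) (y i)" for k i
    define u where "u k = (\<Sum>i\<in>J. mul n (x i) (z k i))" for k
    have z_red: "reduced (z k i)" and z_deg: "degree_le (D - 1 - d i) (z k i)" if "i \<in> J" for k i
      using reduced_cofactor[OF y(1)[OF that]] degree_le_cofactor[OF y(2)[OF that], of "Bvar k j"]
      by (simp_all add: z_def algebra_simps)
    \<comment> \<open>The vector of the \<open>u k\<close> has leading part $(\sum_l t_l a_{lk})_k$.\<close>
    have u: "degree_le (D - 2) (u k + reindex 0 k (u 0))" if "k < n" for k
    proof -
      have "degree_le (D - 2) (\<Sum>i\<in>J. mul n (x i) (z k i) + reindex 0 k (mul n (x i) (z 0 i)))"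
      proof (rule sumrel[OF _ rel'[of "Bvar k j"]])
        fix i assume "i \<in> J"
        from cofactor_mul_B[OF that x(2)[OF this] y(2)[OF this] nonconst[OF this], of j]
        show "degree_le (D - 2) (cofactor (Bvar k j) (mul n (x i) (y i)) +
            (mul n (x i) (z k i) + reindex 0 k (mul n (x i) (z 0 i))))"
          by (simp add: z_def)
      qed
      then show ?thesis by (simp add: u_def sum.distrib)
    qed
    \<comment> \<open>Only for these \<open>i\<close> are the \<open>z k i\<close> bounded by degree zero.\<close>
    have "card {i\<in>J. d i = D - 1} < n"
      by (rule le_less_trans[OF card_mono J(2)]) (use J in auto)
    then obtain C where C: "C \<subseteq> {..<n}" "C \<noteq> {}"
      "\<forall>i\<in>{i\<in>J. d i = D - 1}. (\<Sum>k\<in>C. lookup (z k i) []) = 0"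
      using bit_kernel[of "{i\<in>J. d i = D - 1}" n "\<lambda>i k. lookup (z k i) []"] J(1) by auto
    define Y where "Y i = (\<Sum>k\<in>C. z k i)" for i
    have Y_red: "reduced (Y i)" and Y_deg: "degree_le (D - 1 - d i) (Y i)" if "i \<in> J" for i
      unfolding Y_def using that by (auto intro: reduced_sum degree_le_sum z_red z_deg)
    have Yconst: "D - 1 - d i \<noteq> 0 \<or> Y i = 0" if i: "i \<in> J" for i
    proof (rule ccontr)
      assume *: "\<not> ?thesis"
      then have "Y i = mon []" using Y_deg[OF i] by (intro degree_le_0_const) auto
      then have "lookup (Y i) [] = 1" by simp
      moreover have "lookup (Y i) [] = 0" using C(3) i * by (auto simp: Y_def lookup_sum)
      ultimately show False by simp
    qed
    obtain k0 where k0: "k0 \<in> C" using C(2) by blast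
    have finC: "finite C" using C(1) by (rule finite_subset) simp
    have swap: "(\<Sum>i\<in>J. mul n (x i) (Y i)) = (\<Sum>k\<in>C. u k)"
      unfolding Y_def u_def mul_sum_right by (rule sum.swap)
    have low: "degree_le (D - 2 - d i) (z k i + reindex k0 k (Y i))" if k: "k < n" and i: "i \<in> J" for k i
    proof (rule IH[where y = "\<lambda>i. z k i + reindex k0 k (Y i)", OF _ _ _ i])
      show "reduced (z k i + reindex k0 k (Y i))" "degree_le (D - 1 - d i) (z k i + reindex k0 k (Y i))"
        if "i \<in> J" for i
        using that by (auto intro: reduced_add reduced_reindex degree_le_add degree_le_reindex z_red z_deg Y_red Y_deg)
      have "degree_le (D - 2) (\<Sum>i\<in>J. reindex k0 k (mul n (x i) (Y i)) + mul n (x i) (reindex k0 k (Y i)))"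
      proof (rule degree_le_sum)
        fix i assume i: "i \<in> J"
        from reindex_mul[OF x(2)[OF i] Y_deg[OF i] Yconst[OF i], of k0 k n]
        show "degree_le (D - 2) (reindex k0 k (mul n (x i) (Y i)) + mul n (x i) (reindex k0 k (Y i)))" by simp
      qed
      then have 1: "degree_le (D - 2) (reindex k0 k (\<Sum>k\<in>C. u k) + (\<Sum>i\<in>J. mul n (x i) (reindex k0 k (Y i))))"
        unfolding sum.distrib swap[symmetric] reindex_simps .
      have "degree_le (D - 2) (reindex k0 k (\<Sum>k\<in>C. u k + reindex 0 k (u 0)))"
        using u C(1) by (intro degree_le_reindex degree_le_sum) blast
      also have "(\<Sum>k'\<in>C. reindex k0 k (reindex 0 k' (u 0))) = reindex 0 k (u 0)"
        using k0 finC by (simp add: reindex_reindex)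
      then have "reindex k0 k (\<Sum>k\<in>C. u k + reindex 0 k (u 0)) = reindex k0 k (\<Sum>k\<in>C. u k) + reindex 0 k (u 0)"
        by (simp only: sum.distrib reindex_simps)
      finally have 2: "degree_le (D - 2) (reindex k0 k (\<Sum>k\<in>C. u k) + reindex 0 k (u 0))" .
      have "degree_le (D - 2) (u k + (\<Sum>i\<in>J. mul n (x i) (reindex k0 k (Y i))))"
        using degree_le_add[OF degree_le_add[OF 1 2] u[OF k]] by (simp add: ac_simps)
      then show "degree_le (D - 2) (\<Sum>i\<in>J. mul n (x i) (z k i + reindex k0 k (Y i)))"
        by (simp add: u_def sum.distrib mul_add_right)
    qed
    \<comment> \<open>No word of \<open>y i\<close> ends in $a_{l0} b_{0j}$, so \<open>z 0 i\<close> does not help to cancel \<open>reindex k0 0 (Y i)\<close>.\<close>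
    have "reindex 0 k (z 0 i) = 0" using reindex_cofactor_reduced[OF y(1)[OF i]] by (simp add: z_def)
    then have "degree_le (D - 2 - d i) (reindex k0 k (Y i))"
      using degree_le_reindex[OF low[OF n i], of 0 k] by (simp add: reindex_reindex)
    then have "degree_le (D - 2 - d i) (z k i)"
      using degree_le_cancel[of "D - 2 - d i" "reindex k0 k (Y i)" "z k i"] low[OF k i] by (simp add: add.commute)
    then show ?thesis by (simp add: c z_def)
  qed
  show ?thesis
  proof (cases "0 \<le> D - 1 - d i")
    case True
    then show ?thesis using cofactor_low[OF iJ] by (intro degree_le_from_cofactor[OF _ True]) (simp add: algebra_simps)
  next
    case False
    then have "y i = 0" using nonconst[OF iJ] degree_le_neg[OF y(2)[OF iJ]] by force
    then show ?thesis by simp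
  qed
qed

text \<open>Cohn's weak algorithm for fewer than \<open>n\<close> terms: if the \<open>x i\<close> are not right dependent, then
cancellation of leading terms in \<open>\<Sum>i. x i * y i\<close> forces each \<open>y i\<close> to have lower degree
than its bound.\<close>

lemma weak_algorithm:
  assumes J: "finite J" "card J < n"
    and x: "\<And>i. i \<in> J \<Longrightarrow> 0 \<le> d i" "\<And>i. i \<in> J \<Longrightarrow> degree_le (d i) (x i)"
    and indep: "\<not> right_dependent n J d x"
    and y: "\<And>i. i \<in> J \<Longrightarrow> reduced (y i)" "\<And>i. i \<in> J \<Longrightarrow> degree_le (D - d i) (y i)"
    and rel: "degree_le (D - 1) (\<Sum>i\<in>J. mul n (x i) (y i))"
    and "i \<in> J"
  shows "degree_le (D - 1 - d i) (y i)"
proof -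
  have "degree_le (D - 1 - d i) (y i)"
    if "D < int N" "\<And>i. i \<in> J \<Longrightarrow> reduced (y i)" "\<And>i. i \<in> J \<Longrightarrow> degree_le (D - d i) (y i)"
      "degree_le (D - 1) (\<Sum>i\<in>J. mul n (x i) (y i))" "i \<in> J" for N D y i
    using that
  proof (induction N arbitrary: D y i)
    case 0
    then have "y i = 0" using x(1)[of i] by (intro degree_le_neg[of "D - d i"]) auto
    then show ?case by simp
  next
    case (Suc N)
    show ?case
    proof (rule weak_algorithm_step[OF J x indep _ Suc.prems(2-5)])
      fix y i assume "\<And>i. i \<in> J \<Longrightarrow> reduced (y i)" "\<And>i. i \<in> J \<Longrightarrow> degree_le (D - 1 - d i) (y i)"
        "degree_le (D - 2) (\<Sum>i\<in>J. mul n (x i) (y i))" "i \<in> J"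
      then show "degree_le (D - 2 - d i) (y i)"
        using Suc.IH[of "D - 1" y i] Suc.prems(1) by (simp add: algebra_simps)
    qed
  qed
  from this[of D "nat (D + 1)"] y rel \<open>i \<in> J\<close> show ?thesis by simp
qed

section \<open>Right invertible matrices\<close>

lemma mon_neq_0 [simp]: "mon w \<noteq> 0"
proof -
  have "lookup (mon w) w \<noteq> lookup 0 w" by simp
  then show ?thesis by fastforce
qed

lemma elt_add_eqD: "(x :: elt) + y = z \<Longrightarrow> y = z + x"
  by (auto simp: ac_simps)

text \<open>Replacing a column \<open>x i\<close> by its sum with a combination of the other columns, and correcting \<open>y\<close> by
the inverse row operation, does not change the product.\<close>

lemma column_operation:
  assumes "finite J" "i \<in> J"
  shows "(\<Sum>j\<in>J. mul n (if j = i then x i + (\<Sum>j\<in>J - {i}. mul n (x j) (c j)) else x j)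
      (if j = i then y i else y j + mul n (c j) (y i))) = (\<Sum>j\<in>J. mul n (x j) (y j))"
proof -
  have "(\<Sum>j\<in>J - {i}. mul n (if j = i then x i + (\<Sum>j\<in>J - {i}. mul n (x j) (c j)) else x j)
      (if j = i then y i else y j + mul n (c j) (y i))) =
      (\<Sum>j\<in>J - {i}. mul n (x j) (y j) + mul n (mul n (x j) (c j)) (y i))"
    by (rule sum.cong) (simp_all add: mul_add_right mul_assoc)
  also have "\<dots> = (\<Sum>j\<in>J - {i}. mul n (x j) (y j)) + mul n (\<Sum>j\<in>J - {i}. mul n (x j) (c j)) (y i)"
    by (simp only: sum.distrib mul_sum_left)
  finally show ?thesis
    by (simp add: sum.remove[OF assms] mul_add_left ac_simps)
qed

text \<open>The matrix \<open>Y\<close>, with rows in \<open>J\<close> and columns in \<open>P\<close>, is a right inverse of \<open>X\<close>, with rows in \<open>P\<close>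
and columns in \<open>J\<close>; the entries of both are reduced.\<close>

definition right_inverse :: "nat \<Rightarrow> nat set \<Rightarrow> nat set \<Rightarrow> (nat \<Rightarrow> nat \<Rightarrow> elt) \<Rightarrow> (nat \<Rightarrow> nat \<Rightarrow> elt) \<Rightarrow> bool" where
  "right_inverse n P J X Y \<longleftrightarrow> (\<forall>r\<in>P. \<forall>j\<in>J. reduced (X r j)) \<and> (\<forall>j\<in>J. \<forall>q\<in>P. reduced (Y j q)) \<and>
     (\<forall>r\<in>P. \<forall>q\<in>P. (\<Sum>j\<in>J. mul n (X r j) (Y j q)) = (if r = q then mon [] else 0))"

text \<open>Euclidean reduction of a unimodular row: as long as the entries of row \<open>p\<close> are right dependent,
a column operation lowers a degree bound; \<open>e j\<close> bounds the degree plus one, hence \<open>e j = 0\<close>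
for a zero entry. If they are independent, the weak algorithm applied to $\sum_j x_j y_j = 1$
shows that all products are constant, so that some entry is the unit.\<close>

lemma row_reduce:
  assumes J: "finite J" "card J < n" and p: "p \<in> P"
    and XY: "right_inverse n P J X Y"
    and e: "\<And>j. j \<in> J \<Longrightarrow> degree_le (int (e j) - 1) (X p j)"
  shows "\<exists>X Y. right_inverse n P J X Y \<and> (\<exists>i\<in>J. X p i = mon [])"
  using XY e
proof (induction "\<Sum>j\<in>J. e j" arbitrary: X Y e rule: less_induct)
  case less
  note redX = less.prems(1)[unfolded right_inverse_def, THEN conjunct1, rule_format]
  note redY = less.prems(1)[unfolded right_inverse_def, THEN conjunct2, THEN conjunct1, rule_format]
  note rel = less.prems(1)[unfolded right_inverse_def, THEN conjunct2, THEN conjunct2, rule_format]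
  define K where "K = {j\<in>J. 0 < e j}"
  define d where "d j = int (e j) - 1" for j
  have K: "finite K" "K \<subseteq> J" "card K < n"
    using J card_mono[OF J(1), of K] by (auto simp: K_def)
  have zero: "X p j = 0" if "j \<in> J" "j \<notin> K" for j
    using less.prems(2)[OF that(1)] that by (intro degree_le_neg) (auto simp: K_def)
  show ?case
  proof (cases "right_dependent n K d (X p)")
    case True
    then obtain i c where i: "i \<in> K" and c: "\<forall>j\<in>K - {i}. reduced (c j) \<and> degree_le (d i - d j) (c j)"
      and low: "degree_le (d i - 1) (X p i + (\<Sum>j\<in>K - {i}. mul n (X p j) (c j)))"
      unfolding right_dependent_def by blast
    define c' where "c' j = (if j \<in> K - {i} then c j else 0)" for j
    define X' where "X' r j = (if j = i then X r i + (\<Sum>j\<in>J - {i}. mul n (X r j) (c' j)) else X r j)" for r j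
    define Y' where "Y' j q = (if j = i then Y i q else Y j q + mul n (c' j) (Y i q))" for j q
    have iJ: "i \<in> J" using i K by blast
    have c'_red: "reduced (c' j)" for j using c by (simp add: c'_def)
    have "right_inverse n P J X' Y'"
      unfolding right_inverse_def
    proof (intro conjI ballI)
      fix r j assume r: "r \<in> P" and j: "j \<in> J"
      have "reduced (mul n (X r j) (c' j))" if "j \<in> J - {i}" for j
        using reduced_mul[OF redX[OF r]] that by blast
      then have "reduced (\<Sum>j\<in>J - {i}. mul n (X r j) (c' j))"
        by (rule reduced_sum)
      then show "reduced (X' r j)"
        unfolding X'_def using redX[OF r j] redX[OF r iJ] by (simp add: reduced_add)
      show "reduced (Y' j r)"
        unfolding Y'_def using redY[OF j r] redY[OF iJ r] reduced_mul[OF c'_red] by (simp add: reduced_add)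
    next
      fix r q assume "r \<in> P" "q \<in> P"
      from rel[OF this] show "(\<Sum>j\<in>J. mul n (X' r j) (Y' j q)) = (if r = q then mon [] else 0)"
        unfolding X'_def Y'_def using column_operation[OF J(1) iJ, of n "X r" c' "\<lambda>j. Y j q"] by simp
    qed
    moreover have "(\<Sum>j\<in>J. (e(i := e i - 1)) j) < (\<Sum>j\<in>J. e j)"
      using J(1) iJ i by (intro sum_strict_mono_ex1) (auto simp: K_def)
    moreover have "degree_le (int ((e(i := e i - 1)) j) - 1) (X' p j)" if "j \<in> J" for j
    proof (cases "j = i")
      case True
      have "(\<Sum>j\<in>J - {i}. mul n (X p j) (c' j)) = (\<Sum>j\<in>K - {i}. mul n (X p j) (c j))"
        using J(1) K(2) by (intro sum.mono_neutral_cong_right) (auto simp: c'_def)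
      then show ?thesis using low i True by (simp add: X'_def d_def K_def of_nat_diff)
    qed (use less.prems(2)[OF that] in \<open>simp add: X'_def\<close>)
    ultimately show ?thesis using less.hyps by blast
  next
    case False
    have relp: "(\<Sum>j\<in>K. mul n (X p j) (Y j p)) = mon []"
      using rel[OF p p] sum.mono_neutral_right[OF J(1) K(2), of "\<lambda>j. mul n (X p j) (Y j p)"] zero
      by auto
    \<comment> \<open>The bounds descend by one step as long as the sum of the bounded products, which is \<open>1\<close>, lies below.\<close>
    have step: "\<forall>j\<in>K. degree_le (0 - d j) (Y j p)" if "\<forall>j\<in>K. degree_le (int m - d j) (Y j p)" for m
      using that
    proof (induction m)
      case (Suc m)
      have "degree_le (int (Suc m) - 1 - d j) (Y j p)" if "j \<in> K" for j
      proof (rule weak_algorithm[OF K(1,3) _ _ False _ _ _ that])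
        show "degree_le (int (Suc m) - 1) (\<Sum>j\<in>K. mul n (X p j) (Y j p))" by (simp add: relp)
      qed (use Suc.prems redY K p less.prems(2) in \<open>auto simp: d_def K_def\<close>)
      then show ?case using Suc.IH by simp
    qed simp
    have "\<forall>j. \<exists>m::nat. degree_le (int m - 1) (Y j p)" using degree_le_ex by blast
    then obtain f where f: "\<And>j. degree_le (int (f j) - 1) (Y j p)" by metis
    have "\<forall>j\<in>K. degree_le (int (\<Sum>j\<in>K. f j + e j) - d j) (Y j p)"
    proof
      fix j assume "j \<in> K"
      then have "f j + e j \<le> (\<Sum>j\<in>K. f j + e j)" using member_le_sum[of j K "\<lambda>j. f j + e j"] K(1) by simp
      then have "int (f j) - 1 \<le> int (\<Sum>j\<in>K. f j + e j) - d j"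
        unfolding d_def by linarith
      then show "degree_le (int (\<Sum>j\<in>K. f j + e j) - d j) (Y j p)"
        by (rule degree_le_mono[OF f])
    qed
    from step[OF this] have Y0: "\<forall>j\<in>K. degree_le (0 - d j) (Y j p)" .
    have "\<exists>i\<in>K. mul n (X p i) (Y i p) \<noteq> 0"
    proof (rule ccontr)
      assume "\<not> ?thesis"
      then have "mon [] = 0" by (simp flip: relp)
      then show False by simp
    qed
    then obtain i where i: "i \<in> K" "mul n (X p i) (Y i p) \<noteq> 0" by blast
    then have "X p i \<noteq> 0" "Y i p \<noteq> 0" by auto
    then have "d i \<le> 0" using Y0 i(1) degree_le_neg[of "0 - d i" "Y i p"] by force
    then have "degree_le 0 (X p i)"
      using less.prems(2)[of i] i K(2) degree_le_mono[of "d i" "X p i" 0] by (auto simp: d_def)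
    then have "X p i = mon []" using \<open>X p i \<noteq> 0\<close> by (rule degree_le_0_const)
    then show ?thesis using less.prems(1) i(1) K(2) by blast
  qed
qed

text \<open>Over $S_n$ a right invertible matrix with fewer than \<open>n\<close> columns has no more rows than
columns: a unit in a row splits off that row and its column.\<close>

theorem no_right_inverse:
  assumes "finite P" "finite J" "card J < n" "card J < card P"
  shows "\<not> right_inverse n P J X Y"
  using assms
proof (induction "card J" arbitrary: J P X Y)
  case 0
  then obtain p where "p \<in> P" by fastforce
  then show ?case using 0 by (auto simp: right_inverse_def)
next
  case (Suc m)
  show ?case
  proof
    assume XY: "right_inverse n P J X Y"
    obtain p where p: "p \<in> P" using Suc.prems by fastforce
    have "\<forall>j. \<exists>m::nat. degree_le (int m - 1) (X p j)" using degree_le_ex by blast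
    then obtain e where "\<And>j. degree_le (int (e j) - 1) (X p j)" by metis
    from row_reduce[OF Suc.prems(2,3) p XY this] obtain X Y i
      where XY: "right_inverse n P J X Y" and i: "i \<in> J" and Xi: "X p i = mon []" by blast
    note redX = XY[unfolded right_inverse_def, THEN conjunct1, rule_format]
    note redY = XY[unfolded right_inverse_def, THEN conjunct2, THEN conjunct1, rule_format]
    note rel = XY[unfolded right_inverse_def, THEN conjunct2, THEN conjunct2, rule_format]
    define X' where "X' r j = X r j + mul n (X r i) (X p j)" for r j
    have "right_inverse n (P - {p}) (J - {i}) X' Y"
      unfolding right_inverse_def
    proof (intro conjI ballI)
      fix r j assume "r \<in> P - {p}" "j \<in> J - {i}"
      then show "reduced (X' r j)" "reduced (Y j r)"
        using p i by (auto simp: X'_def intro!: reduced_add reduced_mul redX redY)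
    next
      fix r q assume r: "r \<in> P - {p}" and q: "q \<in> P - {p}"
      have 1: "(\<Sum>j\<in>J - {i}. mul n (X s j) (Y j q)) = (if s = q then mon [] else 0) + mul n (X s i) (Y i q)"
        if "s \<in> P" for s
      proof -
        have "(\<Sum>j\<in>J. mul n (X s j) (Y j q)) = (if s = q then mon [] else 0)"
          using rel[OF that] q by simp
        then have "mul n (X s i) (Y i q) + (\<Sum>j\<in>J - {i}. mul n (X s j) (Y j q)) =
            (if s = q then mon [] else 0)"
          unfolding sum.remove[OF Suc.prems(2) i] .
        then show ?thesis by (rule elt_add_eqD)
      qed
      have "reduced (Y i q)" using redY[OF i] q by simp
      then have "(\<Sum>j\<in>J - {i}. mul n (X p j) (Y j q)) = Y i q"
        using 1[OF p] q by (auto simp: Xi mul_one_left simp del: mul_mon)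
      then have "(\<Sum>j\<in>J - {i}. mul n (X' r j) (Y j q)) =
          (\<Sum>j\<in>J - {i}. mul n (X r j) (Y j q)) + mul n (X r i) (Y i q)"
        by (simp add: X'_def mul_add_left sum.distrib mul_assoc flip: mul_sum_right)
      also have "\<dots> = (if r = q then mon [] else 0)"
        using 1[of r] r by (simp add: add.assoc)
      finally show "(\<Sum>j\<in>J - {i}. mul n (X' r j) (Y j q)) = (if r = q then mon [] else 0)" .
    qed
    moreover have "m = card (J - {i})" "card (J - {i}) < card (P - {p})" "card (J - {i}) < n"
      "finite (P - {p})" "finite (J - {i})"
      using Suc.hyps(2) Suc.prems i p by simp_all
    ultimately show False
      using Suc.hyps(1)[of "J - {i}" "P - {p}" X' Y] by blast
  qed
qed

section \<open>Generating numbers by matrices\<close>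

lemma (in abelian_monoid) finsum_swap:
  assumes "finite A" "finite B" "\<And>x y. x \<in> A \<Longrightarrow> y \<in> B \<Longrightarrow> f x y \<in> carrier G"
  shows "(\<Oplus>x\<in>A. \<Oplus>y\<in>B. f x y) = (\<Oplus>y\<in>B. \<Oplus>x\<in>A. f x y)"
  using assms(1,3)
proof (induction A rule: finite_induct)
  case (insert a A)
  have "(\<Oplus>y\<in>B. \<Oplus>x\<in>insert a A. f x y) = (\<Oplus>y\<in>B. f a y \<oplus> (\<Oplus>x\<in>A. f x y))"
    using insert by (intro finsum_cong') (auto intro!: finsum_insert finsum_closed)
  also have "\<dots> = (\<Oplus>y\<in>B. f a y) \<oplus> (\<Oplus>y\<in>B. \<Oplus>x\<in>A. f x y)"
    using insert by (intro finsum_addf) (auto intro!: finsum_closed)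
  also have "\<dots> = (\<Oplus>x\<in>insert a A. \<Oplus>y\<in>B. f x y)"
    using insert by (subst finsum_insert) (auto intro!: finsum_closed)
  finally show ?case by simp
qed simp

text \<open>There are matrices $a$ of size $(k+1) \times k$ and $b$ of size $k \times (k+1)$ over $S$ with
$ab = 1$. For a ring $S$ this says that there is an epimorphism from $S^k$ to $S^{k+1}$, which splits
as its target is free.\<close>

definition retraction_matrices :: "('a, 'r) ring_scheme \<Rightarrow> nat \<Rightarrow> bool" where
  "retraction_matrices S k \<longleftrightarrow> (\<exists>a b. (\<forall>l\<le>k. \<forall>i<k. a l i \<in> carrier S) \<and> (\<forall>i<k. \<forall>j\<le>k. b i j \<in> carrier S) \<and>
     (\<forall>l\<le>k. \<forall>j\<le>k. (\<Oplus>\<^bsub>S\<^esub>i\<in>{..<k}. a l i \<otimes>\<^bsub>S\<^esub> b i j) = (if l = j then \<one>\<^bsub>S\<^esub> else \<zero>\<^bsub>S\<^esub>)))"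

lemma epi_imp_matrices:
  assumes "ring S" and "right_module_epi S (free_right_module S k) (free_right_module S (k + 1)) \<noteq> {}"
  shows "retraction_matrices S k"
proof -
  interpret ring S by fact
  let ?F = "free_right_module S k" and ?H = "free_right_module S (k + 1)"
  obtain f where f: "f \<in> right_module_epi S ?F ?H" using assms(2) by blast
  then have hom: "f \<in> right_module_hom S ?F ?H" and onto: "f ` carrier ?F = carrier ?H"
    by (simp_all only: right_module_epi_def mem_Collect_eq)
  note hom = hom[unfolded right_module_hom_def mem_Collect_eq]
  note closed = hom[THEN conjunct1, THEN funcset_mem]
  note add = hom[THEN conjunct2, THEN conjunct1, rule_format]
  note smult = hom[THEN conjunct2, THEN conjunct2, rule_format]
  define e where "e i = (\<lambda>j\<in>{..<k}. if j = i then \<one>\<^bsub>S\<^esub> else \<zero>\<^bsub>S\<^esub>)" for i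
  have e: "e i \<in> carrier ?F" for i by (auto simp: e_def)
  have fe: "f (e i) l \<in> carrier S" if "l \<le> k" for i l
    using closed[OF e] that by (auto simp: PiE_iff)
  have f0: "f (\<lambda>i\<in>{..<k}. \<zero>\<^bsub>S\<^esub>) = (\<lambda>l\<in>{..<k + 1}. \<zero>\<^bsub>S\<^esub>)"
  proof -
    have "(\<lambda>i\<in>{..<k}. \<zero>\<^bsub>S\<^esub>) = \<zero>\<^bsub>S\<^esub> \<odot>\<^bsub>?F\<^esub> e 0" by (auto simp: e_def fun_eq_iff)
    then have "f (\<lambda>i\<in>{..<k}. \<zero>\<^bsub>S\<^esub>) = \<zero>\<^bsub>S\<^esub> \<odot>\<^bsub>?H\<^esub> f (e 0)" using smult[OF _ e] by simp
    also have "\<dots> = (\<lambda>l\<in>{..<k + 1}. \<zero>\<^bsub>S\<^esub>)"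
      using fe by (auto simp: fun_eq_iff simp del: One_nat_def)
    finally show ?thesis .
  qed
  have f_eq: "f x l = (\<Oplus>\<^bsub>S\<^esub>i\<in>{..<k}. f (e i) l \<otimes>\<^bsub>S\<^esub> x i)" if x: "x \<in> carrier ?F" and l: "l \<le> k" for x l
  proof -
    have xc: "x i \<in> carrier S" if "i < k" for i using x that by (auto simp: PiE_iff)
    have "f (\<lambda>i\<in>{..<k}. if i < t then x i else \<zero>\<^bsub>S\<^esub>) l = (\<Oplus>\<^bsub>S\<^esub>i\<in>{..<t}. f (e i) l \<otimes>\<^bsub>S\<^esub> x i)"
      if "t \<le> k" for t
      using that
    proof (induction t)
      case 0
      have "(\<lambda>i\<in>{..<k}. if i < 0 then x i else \<zero>\<^bsub>S\<^esub>) = (\<lambda>i\<in>{..<k}. \<zero>\<^bsub>S\<^esub>)"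
        by (intro restrict_ext) simp
      then have "f (\<lambda>i\<in>{..<k}. if i < 0 then x i else \<zero>\<^bsub>S\<^esub>) l = \<zero>\<^bsub>S\<^esub>"
        using l by (simp only: f0) simp
      then show ?case by (simp only: lessThan_0 finsum_empty)
    next
      case (Suc t)
      let ?y = "\<lambda>t. \<lambda>i\<in>{..<k}. if i < t then x i else \<zero>\<^bsub>S\<^esub>"
      have t: "t < k" using Suc.prems by simp
      have 1: "?y (Suc t) = ?y t \<oplus>\<^bsub>?F\<^esub> (x t \<odot>\<^bsub>?F\<^esub> e t)"
        using xc t by (auto simp: e_def fun_eq_iff less_Suc_eq)
      have 2: "?y t \<in> carrier ?F" using xc by auto
      have 3: "x t \<odot>\<^bsub>?F\<^esub> e t \<in> carrier ?F" using xc t by (auto simp: e_def)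
      \<comment> \<open>The first \<open>Suc t\<close> coordinates arise by adding a multiple of a basis vector.\<close>
      have "f (?y (Suc t)) = f (?y t) \<oplus>\<^bsub>?H\<^esub> (x t \<odot>\<^bsub>?H\<^esub> f (e t))"
        unfolding 1 add[OF 2 3] smult[OF xc[OF t] e] ..
      then have "f (?y (Suc t)) l = f (?y t) l \<oplus>\<^bsub>S\<^esub> f (e t) l \<otimes>\<^bsub>S\<^esub> x t"
        using l by simp
      also have "\<dots> = (\<Oplus>\<^bsub>S\<^esub>i\<in>{..<t}. f (e i) l \<otimes>\<^bsub>S\<^esub> x i) \<oplus>\<^bsub>S\<^esub> f (e t) l \<otimes>\<^bsub>S\<^esub> x t"
        unfolding Suc.IH[OF Suc_leD[OF Suc.prems]] ..
      also have "\<dots> = (\<Oplus>\<^bsub>S\<^esub>i\<in>{..<Suc t}. f (e i) l \<otimes>\<^bsub>S\<^esub> x i)"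
        unfolding lessThan_Suc using fe[OF l] xc Suc.prems
        by (subst finsum_insert) (auto simp: a_comm intro!: finsum_closed)
      finally show ?case .
    qed
    from this[of k] have "f (\<lambda>i\<in>{..<k}. if i < k then x i else \<zero>\<^bsub>S\<^esub>) l =
        (\<Oplus>\<^bsub>S\<^esub>i\<in>{..<k}. f (e i) l \<otimes>\<^bsub>S\<^esub> x i)" by simp
    moreover have "(\<lambda>i\<in>{..<k}. if i < k then x i else \<zero>\<^bsub>S\<^esub>) = x"
      using x by (auto simp: fun_eq_iff PiE_iff extensional_def)
    ultimately show ?thesis by simp
  qed
  have "\<forall>j. \<exists>x. x \<in> carrier ?F \<and> f x = (\<lambda>l\<in>{..<k + 1}. if l = j then \<one>\<^bsub>S\<^esub> else \<zero>\<^bsub>S\<^esub>)"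
  proof
    fix j
    have "(\<lambda>l\<in>{..<k + 1}. if l = j then \<one>\<^bsub>S\<^esub> else \<zero>\<^bsub>S\<^esub>) \<in> f ` carrier ?F"
      unfolding onto by auto
    then show "\<exists>x. x \<in> carrier ?F \<and> f x = (\<lambda>l\<in>{..<k + 1}. if l = j then \<one>\<^bsub>S\<^esub> else \<zero>\<^bsub>S\<^esub>)"
      by (elim imageE) (intro exI conjI, assumption, rule sym)
  qed
  from choice[OF this] obtain x where "\<forall>j. x j \<in> carrier ?F \<and>
      f (x j) = (\<lambda>l\<in>{..<k + 1}. if l = j then \<one>\<^bsub>S\<^esub> else \<zero>\<^bsub>S\<^esub>)" ..
  then have x: "x j \<in> carrier ?F"
    and fx: "f (x j) = (\<lambda>l\<in>{..<k + 1}. if l = j then \<one>\<^bsub>S\<^esub> else \<zero>\<^bsub>S\<^esub>)" for j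
    by (simp_all only:)
  have "x j i \<in> carrier S" if "i < k" for i j
    using x[of j] that by (auto simp: PiE_iff)
  moreover have "(\<Oplus>\<^bsub>S\<^esub>i\<in>{..<k}. f (e i) l \<otimes>\<^bsub>S\<^esub> x j i) = (if l = j then \<one>\<^bsub>S\<^esub> else \<zero>\<^bsub>S\<^esub>)"
    if "l \<le> k" for l j
    using f_eq[OF x that] fx that by simp
  ultimately show ?thesis
    unfolding retraction_matrices_def using fe
    by (intro exI[of _ "\<lambda>l i. f (e i) l"] exI[of _ "\<lambda>i j. x j i"]) simp
qed

lemma matrices_imp_epi:
  assumes "ring S" and "retraction_matrices S k"
  shows "right_module_epi S (free_right_module S k) (free_right_module S (k + 1)) \<noteq> {}"
proof -
  interpret ring S by fact
  let ?F = "free_right_module S k" and ?H = "free_right_module S (k + 1)"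
  from assms(2)[unfolded retraction_matrices_def] obtain a b where *:
    "(\<forall>l\<le>k. \<forall>i<k. a l i \<in> carrier S) \<and> (\<forall>i<k. \<forall>j\<le>k. b i j \<in> carrier S) \<and>
     (\<forall>l\<le>k. \<forall>j\<le>k. (\<Oplus>\<^bsub>S\<^esub>i\<in>{..<k}. a l i \<otimes>\<^bsub>S\<^esub> b i j) = (if l = j then \<one>\<^bsub>S\<^esub> else \<zero>\<^bsub>S\<^esub>))"
    by (elim exE) (rule that)
  note a = *[THEN conjunct1, rule_format]
    and b = *[THEN conjunct2, THEN conjunct1, rule_format]
    and ab = *[THEN conjunct2, THEN conjunct2, rule_format]
  define f where "f x = (\<lambda>l\<in>{..<k + 1}. \<Oplus>\<^bsub>S\<^esub>i\<in>{..<k}. a l i \<otimes>\<^bsub>S\<^esub> x i)" for x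
  have mem: "x i \<in> carrier S" if "x \<in> carrier ?F" "i < k" for x i
    using that by (auto simp: PiE_iff)
  have "f \<in> right_module_hom S ?F ?H"
    unfolding right_module_hom_def
  proof (intro CollectI conjI ballI Pi_I)
    fix x assume x: "x \<in> carrier ?F"
    show "f x \<in> carrier ?H"
      using a mem[OF x] by (auto simp: f_def less_Suc_eq_le intro!: finsum_closed)
    fix y assume y: "y \<in> carrier ?F"
    have "(\<Oplus>\<^bsub>S\<^esub>i\<in>{..<k}. a l i \<otimes>\<^bsub>S\<^esub> (x i \<oplus>\<^bsub>S\<^esub> y i)) =
        (\<Oplus>\<^bsub>S\<^esub>i\<in>{..<k}. a l i \<otimes>\<^bsub>S\<^esub> x i) \<oplus>\<^bsub>S\<^esub> (\<Oplus>\<^bsub>S\<^esub>i\<in>{..<k}. a l i \<otimes>\<^bsub>S\<^esub> y i)" if "l \<le> k" for l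
    proof -
      have "(\<Oplus>\<^bsub>S\<^esub>i\<in>{..<k}. a l i \<otimes>\<^bsub>S\<^esub> (x i \<oplus>\<^bsub>S\<^esub> y i)) =
          (\<Oplus>\<^bsub>S\<^esub>i\<in>{..<k}. a l i \<otimes>\<^bsub>S\<^esub> x i \<oplus>\<^bsub>S\<^esub> a l i \<otimes>\<^bsub>S\<^esub> y i)"
        using a[OF that] mem[OF x] mem[OF y] by (intro finsum_cong') (auto simp: r_distr)
      then show ?thesis
        using a[OF that] mem[OF x] mem[OF y] by (simp add: finsum_addf Pi_def)
    qed
    moreover have "f (x \<oplus>\<^bsub>?F\<^esub> y) = (\<lambda>l\<in>{..<k + 1}. \<Oplus>\<^bsub>S\<^esub>i\<in>{..<k}. a l i \<otimes>\<^bsub>S\<^esub> (x i \<oplus>\<^bsub>S\<^esub> y i))"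
      unfolding f_def using a mem[OF x] mem[OF y]
      by (intro restrict_ext finsum_cong') auto
    ultimately show "f (x \<oplus>\<^bsub>?F\<^esub> y) = f x \<oplus>\<^bsub>?H\<^esub> f y"
      by (auto simp: f_def fun_eq_iff)
  next
    fix c x assume c: "c \<in> carrier S" and x: "x \<in> carrier ?F"
    have "(\<Oplus>\<^bsub>S\<^esub>i\<in>{..<k}. a l i \<otimes>\<^bsub>S\<^esub> (x i \<otimes>\<^bsub>S\<^esub> c)) = (\<Oplus>\<^bsub>S\<^esub>i\<in>{..<k}. a l i \<otimes>\<^bsub>S\<^esub> x i) \<otimes>\<^bsub>S\<^esub> c"
      if "l \<le> k" for l
    proof -
      have "(\<Oplus>\<^bsub>S\<^esub>i\<in>{..<k}. a l i \<otimes>\<^bsub>S\<^esub> (x i \<otimes>\<^bsub>S\<^esub> c)) = (\<Oplus>\<^bsub>S\<^esub>i\<in>{..<k}. a l i \<otimes>\<^bsub>S\<^esub> x i \<otimes>\<^bsub>S\<^esub> c)"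
        using a[OF that] mem[OF x] c by (intro finsum_cong') (auto simp: m_assoc)
      then show ?thesis
        using a[OF that] mem[OF x] c by (simp add: finsum_ldistr Pi_def)
    qed
    moreover have "f (c \<odot>\<^bsub>?F\<^esub> x) = (\<lambda>l\<in>{..<k + 1}. \<Oplus>\<^bsub>S\<^esub>i\<in>{..<k}. a l i \<otimes>\<^bsub>S\<^esub> (x i \<otimes>\<^bsub>S\<^esub> c))"
      unfolding f_def using a mem[OF x] c
      by (intro restrict_ext finsum_cong') auto
    ultimately show "f (c \<odot>\<^bsub>?F\<^esub> x) = c \<odot>\<^bsub>?H\<^esub> f x"
      by (auto simp: f_def fun_eq_iff)
  qed
  moreover have "f ` carrier ?F = carrier ?H"
  proof
    show "f ` carrier ?F \<subseteq> carrier ?H"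
      using a mem by (auto simp: f_def less_Suc_eq_le intro!: finsum_closed)
    show "carrier ?H \<subseteq> f ` carrier ?F"
    proof
      fix y assume y: "y \<in> carrier ?H"
      have yc: "y j \<in> carrier S" if "j \<le> k" for j using y that by (auto simp: PiE_iff)
      define x where "x = (\<lambda>i\<in>{..<k}. \<Oplus>\<^bsub>S\<^esub>j\<in>{..k}. b i j \<otimes>\<^bsub>S\<^esub> y j)"
      have x: "x \<in> carrier ?F"
        using b yc by (auto simp: x_def intro!: finsum_closed)
      have "f x l = y l" if l: "l \<le> k" for l
      proof -
        have "f x l = (\<Oplus>\<^bsub>S\<^esub>i\<in>{..<k}. a l i \<otimes>\<^bsub>S\<^esub> (\<Oplus>\<^bsub>S\<^esub>j\<in>{..k}. b i j \<otimes>\<^bsub>S\<^esub> y j))"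
          using l a b yc by (auto simp: f_def x_def intro!: finsum_cong' finsum_closed)
        also have "\<dots> = (\<Oplus>\<^bsub>S\<^esub>i\<in>{..<k}. \<Oplus>\<^bsub>S\<^esub>j\<in>{..k}. a l i \<otimes>\<^bsub>S\<^esub> b i j \<otimes>\<^bsub>S\<^esub> y j)"
        proof (intro finsum_cong' refl)
          fix i assume i: "i \<in> {..<k}"
          have "a l i \<otimes>\<^bsub>S\<^esub> (\<Oplus>\<^bsub>S\<^esub>j\<in>{..k}. b i j \<otimes>\<^bsub>S\<^esub> y j) = (\<Oplus>\<^bsub>S\<^esub>j\<in>{..k}. a l i \<otimes>\<^bsub>S\<^esub> (b i j \<otimes>\<^bsub>S\<^esub> y j))"
            using i l a b yc by (intro finsum_rdistr) auto
          also have "\<dots> = (\<Oplus>\<^bsub>S\<^esub>j\<in>{..k}. a l i \<otimes>\<^bsub>S\<^esub> b i j \<otimes>\<^bsub>S\<^esub> y j)"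
            using i l a b yc by (intro finsum_cong') (auto simp: m_assoc)
          finally show "a l i \<otimes>\<^bsub>S\<^esub> (\<Oplus>\<^bsub>S\<^esub>j\<in>{..k}. b i j \<otimes>\<^bsub>S\<^esub> y j) = (\<Oplus>\<^bsub>S\<^esub>j\<in>{..k}. a l i \<otimes>\<^bsub>S\<^esub> b i j \<otimes>\<^bsub>S\<^esub> y j)" .
        qed (use l a b yc in \<open>auto intro!: finsum_closed\<close>)
        also have "\<dots> = (\<Oplus>\<^bsub>S\<^esub>j\<in>{..k}. \<Oplus>\<^bsub>S\<^esub>i\<in>{..<k}. a l i \<otimes>\<^bsub>S\<^esub> b i j \<otimes>\<^bsub>S\<^esub> y j)"
          using l a b yc by (intro finsum_swap) auto
        also have "\<dots> = (\<Oplus>\<^bsub>S\<^esub>j\<in>{..k}. if l = j then y j else \<zero>\<^bsub>S\<^esub>)"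
        proof (intro finsum_cong' refl)
          fix j assume j: "j \<in> {..k}"
          have "(\<Oplus>\<^bsub>S\<^esub>i\<in>{..<k}. a l i \<otimes>\<^bsub>S\<^esub> b i j \<otimes>\<^bsub>S\<^esub> y j) = (\<Oplus>\<^bsub>S\<^esub>i\<in>{..<k}. a l i \<otimes>\<^bsub>S\<^esub> b i j) \<otimes>\<^bsub>S\<^esub> y j"
            using j l a b yc by (intro finsum_ldistr[symmetric]) auto
          then show "(\<Oplus>\<^bsub>S\<^esub>i\<in>{..<k}. a l i \<otimes>\<^bsub>S\<^esub> b i j \<otimes>\<^bsub>S\<^esub> y j) = (if l = j then y j else \<zero>\<^bsub>S\<^esub>)"
            using ab[OF l, of j] j yc by auto
        qed (use yc in auto)
        also have "\<dots> = y l" using l yc by (intro finsum_singleton) auto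
        finally show ?thesis .
      qed
      moreover have "f x l = y l" if "\<not> l \<le> k" for l
        using y that by (auto simp: f_def PiE_iff extensional_def)
      ultimately have "f x = y" by blast
      then show "y \<in> f ` carrier ?F" using x by blast
    qed
  qed
  ultimately show ?thesis unfolding right_module_epi_def by blast
qed

lemma gn_eqI:
  assumes "ring S" "0 < m" "retraction_matrices S m" "\<And>k. k < m \<Longrightarrow> \<not> retraction_matrices S k"
  shows "gn S = enat m"
proof -
  have E: "right_module_epi S (free_right_module S k) (free_right_module S (k + 1)) \<noteq> {} \<longleftrightarrow>
      retraction_matrices S k" for k
    using epi_imp_matrices matrices_imp_epi assms(1) by blast
  have "(LEAST k. k > 0 \<and> retraction_matrices S k) = m"
    using assms(2-4) by (intro Least_equality) (auto simp: not_less[symmetric])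
  then show ?thesis unfolding gn_def E using assms(2,3) by auto
qed

text \<open>Unital ring homomorphisms preserve the identity $ab = 1$. Hence a homomorphism from $R$ to $T$
bounds the generating number of $R$ from below by that of $T$.\<close>

lemma retraction_matrices_hom:
  assumes "ring R" "ring T" "h \<in> ring_hom R T" "retraction_matrices R k"
  shows "retraction_matrices T k"
proof -
  interpret ring_hom_ring R T h using assms(1-3) by (rule ring_hom_ringI2)
  from assms(4)[unfolded retraction_matrices_def] obtain a b where *:
    "(\<forall>l\<le>k. \<forall>i<k. a l i \<in> carrier R) \<and> (\<forall>i<k. \<forall>j\<le>k. b i j \<in> carrier R) \<and>
     (\<forall>l\<le>k. \<forall>j\<le>k. (\<Oplus>\<^bsub>R\<^esub>i\<in>{..<k}. a l i \<otimes>\<^bsub>R\<^esub> b i j) = (if l = j then \<one>\<^bsub>R\<^esub> else \<zero>\<^bsub>R\<^esub>))"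
    by (elim exE) (rule that)
  note a = *[THEN conjunct1, rule_format]
    and b = *[THEN conjunct2, THEN conjunct1, rule_format]
    and ab = *[THEN conjunct2, THEN conjunct2, rule_format]
  have "(\<Oplus>\<^bsub>T\<^esub>i\<in>{..<k}. h (a l i) \<otimes>\<^bsub>T\<^esub> h (b i j)) = (if l = j then \<one>\<^bsub>T\<^esub> else \<zero>\<^bsub>T\<^esub>)"
    if l: "l \<le> k" and j: "j \<le> k" for l j
  proof -
    have "(\<Oplus>\<^bsub>T\<^esub>i\<in>{..<k}. h (a l i) \<otimes>\<^bsub>T\<^esub> h (b i j)) = (\<Oplus>\<^bsub>T\<^esub>i\<in>{..<k}. (h \<circ> (\<lambda>i. a l i \<otimes>\<^bsub>R\<^esub> b i j)) i)"
      using a b l j by (intro S.finsum_cong') auto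
    also have "\<dots> = h (\<Oplus>\<^bsub>R\<^esub>i\<in>{..<k}. a l i \<otimes>\<^bsub>R\<^esub> b i j)"
      using a b l j by (subst hom_finsum) (auto simp: comp_def)
    finally show ?thesis using ab[OF l j] by simp
  qed
  then show ?thesis
    unfolding retraction_matrices_def using a b
    by (intro exI[of _ "\<lambda>l i. h (a l i)"] exI[of _ "\<lambda>i j. h (b i j)"]) auto
qed

text \<open>$S_n$ as a ring. By \<open>mul_relation\<close> and \<open>no_right_inverse\<close> its generating number is
\<open>n\<close>, for \<open>n > 0\<close>.\<close>

definition cohn_ring :: "nat \<Rightarrow> elt ring" where
  "cohn_ring n = \<lparr>carrier = {x. reduced x}, mult = mul n, one = mon [], zero = 0, add = (+)\<rparr>"

lemma cohn_ring_simps [simp]: "carrier (cohn_ring n) = {x. reduced x}" "mult (cohn_ring n) = mul n"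
  "one (cohn_ring n) = mon []" "zero (cohn_ring n) = 0" "add (cohn_ring n) = (+)"
  by (simp_all add: cohn_ring_def)

lemma ring_cohn_ring: "ring (cohn_ring n)"
proof (intro ringI abelian_groupI monoidI)
  fix x assume "x \<in> carrier (cohn_ring n)"
  then show "\<exists>y\<in>carrier (cohn_ring n). y \<oplus>\<^bsub>cohn_ring n\<^esub> x = \<zero>\<^bsub>cohn_ring n\<^esub>" by (intro bexI[of _ x]) auto
qed (simp_all add: reduced_add reduced_mul mul_one_left mul_assoc mul_add_left mul_add_right ac_simps del: mul_mon)

lemma cohn_ring_finsum:
  assumes "finite A" "\<And>i. i \<in> A \<Longrightarrow> reduced (f i)"
  shows "finsum (cohn_ring n) f A = (\<Sum>i\<in>A. f i)"
  using assms
proof (induction A rule: finite_induct)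
  case (insert a A)
  interpret ring "cohn_ring n" by (rule ring_cohn_ring)
  from insert show ?case by (subst finsum_insert) auto
next
  case empty
  interpret ring "cohn_ring n" by (rule ring_cohn_ring)
  show ?case by simp
qed

lemma cohn_ring_no_matrices:
  assumes "k < n"
  shows "\<not> retraction_matrices (cohn_ring n) k"
proof
  assume "retraction_matrices (cohn_ring n) k"
  from this[unfolded retraction_matrices_def] obtain a b where *:
    "(\<forall>l\<le>k. \<forall>i<k. a l i \<in> carrier (cohn_ring n)) \<and> (\<forall>i<k. \<forall>j\<le>k. b i j \<in> carrier (cohn_ring n)) \<and>
     (\<forall>l\<le>k. \<forall>j\<le>k. (\<Oplus>\<^bsub>cohn_ring n\<^esub>i\<in>{..<k}. a l i \<otimes>\<^bsub>cohn_ring n\<^esub> b i j) = (if l = j then \<one>\<^bsub>cohn_ring n\<^esub> else \<zero>\<^bsub>cohn_ring n\<^esub>))"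
    by (elim exE) (rule that)
  note a = *[THEN conjunct1, rule_format]
    and b = *[THEN conjunct2, THEN conjunct1, rule_format]
    and ab = *[THEN conjunct2, THEN conjunct2, rule_format]
  have "right_inverse n {..k} {..<k} a b"
    unfolding right_inverse_def
  proof (intro conjI ballI)
    fix l j assume "l \<in> {..k}" "j \<in> {..k}"
    then show "(\<Sum>i<k. mul n (a l i) (b i j)) = (if l = j then mon [] else 0)"
      using ab[of l j] cohn_ring_finsum[of "{..<k}" "\<lambda>i. mul n (a l i) (b i j)" n] a by (auto simp: reduced_mul split: if_splits)
  qed (use a b in auto)
  then show False using no_right_inverse[of "{..k}" "{..<k}" n a b] assms by simp
qed

section \<open>Isomorphic images of strongly graded rings\<close>

text \<open>The family \<open>c\<close> is a decomposition of \<open>r\<close> into components in the \<open>C i\<close>.\<close>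

definition decomposition :: "('a, 'r) ring_scheme \<Rightarrow> 'i set \<Rightarrow> ('i \<Rightarrow> 'a set) \<Rightarrow> 'a \<Rightarrow> ('i \<Rightarrow> 'a) \<Rightarrow> bool" where
  "decomposition R I C r c \<longleftrightarrow> c \<in> (\<Pi>\<^sub>E i\<in>I. C i) \<and> finite {i \<in> I. c i \<noteq> \<zero>\<^bsub>R\<^esub>} \<and>
      r = (\<Oplus>\<^bsub>R\<^esub>i\<in>{i \<in> I. c i \<noteq> \<zero>\<^bsub>R\<^esub>}. c i)"

lemma decomposition_hom:
  assumes "ring_hom_ring R T h" "inj_on h (carrier R)" "\<And>i. i \<in> I \<Longrightarrow> C i \<subseteq> carrier R"
    and "decomposition R I C r c"
  shows "decomposition T I (\<lambda>i. h ` C i) (h r) (\<lambda>i\<in>I. h (c i))"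
proof -
  interpret ring_hom_ring R T h by fact
  have c: "c \<in> (\<Pi>\<^sub>E i\<in>I. C i)" and fin: "finite {i \<in> I. c i \<noteq> \<zero>\<^bsub>R\<^esub>}"
    and r: "r = (\<Oplus>\<^bsub>R\<^esub>i\<in>{i \<in> I. c i \<noteq> \<zero>\<^bsub>R\<^esub>}. c i)"
    using assms(4) by (simp_all add: decomposition_def)
  have cR: "c i \<in> carrier R" if "i \<in> I" for i using c assms(3) that by (auto simp: PiE_iff)
  have "h (c i) = \<zero>\<^bsub>T\<^esub> \<longleftrightarrow> c i = \<zero>\<^bsub>R\<^esub>" if "i \<in> I" for i
    using inj_onD[OF assms(2), of "c i" "\<zero>\<^bsub>R\<^esub>"] cR[OF that] by auto
  then have supp: "{i \<in> I. (\<lambda>i\<in>I. h (c i)) i \<noteq> \<zero>\<^bsub>T\<^esub>} = {i \<in> I. c i \<noteq> \<zero>\<^bsub>R\<^esub>}" by auto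
  have "h r = (\<Oplus>\<^bsub>T\<^esub>i\<in>{i \<in> I. c i \<noteq> \<zero>\<^bsub>R\<^esub>}. (h \<circ> c) i)"
    unfolding r using cR by (subst hom_finsum) (auto simp: comp_def)
  also have "\<dots> = (\<Oplus>\<^bsub>T\<^esub>i\<in>{i \<in> I. c i \<noteq> \<zero>\<^bsub>R\<^esub>}. (\<lambda>i\<in>I. h (c i)) i)"
    using cR by (intro S.finsum_cong') auto
  finally have hr: "h r = (\<Oplus>\<^bsub>T\<^esub>i\<in>{i \<in> I. c i \<noteq> \<zero>\<^bsub>R\<^esub>}. (\<lambda>i\<in>I. h (c i)) i)" .
  have "(\<lambda>i\<in>I. h (c i)) \<in> (\<Pi>\<^sub>E i\<in>I. h ` C i)" using c by (auto simp: PiE_iff)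
  then show ?thesis
    unfolding decomposition_def supp by (intro conjI fin hr)
qed

lemma strongly_graded_ring_image:
  fixes R :: "('a, 'r) ring_scheme" and G :: "('g, 'h) monoid_scheme" and \<phi> :: "'a \<Rightarrow> 'b"
  assumes "strongly_graded_ring R G C" "inj_on \<phi> (carrier R)"
  shows "strongly_graded_ring (image_ring \<phi> R) G (\<lambda>g. \<phi> ` C g)"
proof -
  interpret strongly_graded_ring R G C by fact
  define T where "T = image_ring \<phi> R"
  define \<psi> where "\<psi> = inv_into (carrier R) \<phi>"
  have T: "ring T" unfolding T_def by (rule inj_imp_image_ring_is_ring[OF assms(2)])
  have iso: "\<phi> \<in> ring_iso R T" unfolding T_def by (rule inj_imp_image_ring_iso[OF assms(2)])
  have carrier_T: "carrier T = \<phi> ` carrier R" by (simp add: T_def image_ring_carrier)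
  interpret h: ring_hom_ring R T \<phi>
    using ring_hom_ringI2[OF ring_axioms T] iso by (simp add: ring_iso_def)
  interpret k: ring_hom_ring T R \<psi>
    using ring_hom_ringI2[OF T ring_axioms] ring_iso_set_sym[OF ring_axioms iso]
    by (simp add: ring_iso_def \<psi>_def)
  have \<psi>\<phi>: "\<psi> (\<phi> x) = x" if "x \<in> carrier R" for x
    using assms(2) that by (simp add: \<psi>_def)
  have \<phi>\<psi>: "\<phi> (\<psi> y) = y" if "y \<in> carrier T" for y
    using that by (auto simp: carrier_T \<psi>\<phi>)
  have inj\<psi>: "inj_on \<psi> (carrier T)" by (rule inj_on_inverseI) (rule \<phi>\<psi>)
  have sub: "additive_subgroup (C g) R" if "g \<in> carrier G" for g
    using direct_sum that by (simp add: additive_direct_sum_def)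
  then have CR: "C g \<subseteq> carrier R" if "g \<in> carrier G" for g
    using additive_subgroup.a_subset that by blast
  interpret a: group_hom "add_monoid R" "add_monoid T" \<phi>
    using h.a_group_hom .
  have "additive_direct_sum T (carrier G) (\<lambda>g. \<phi> ` C g)"
    unfolding additive_direct_sum_def decomposition_def[symmetric]
  proof (intro conjI ballI)
    fix g assume "g \<in> carrier G"
    then show "additive_subgroup (\<phi> ` C g) T"
      using a.subgroup_img_is_subgroup additive_subgroup.a_subgroup[OF sub]
      by (auto intro: additive_subgroup.intro)
  next
    fix s assume "s \<in> carrier T"
    then obtain r where r: "r \<in> carrier R" and s: "s = \<phi> r" by (auto simp: carrier_T)
    have ex1: "\<exists>!c. decomposition R (carrier G) C r c"
      using direct_sum r unfolding additive_direct_sum_def decomposition_def by blast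
    then obtain c where c: "decomposition R (carrier G) C r c" by blast
    show "\<exists>!c. decomposition T (carrier G) (\<lambda>g. \<phi> ` C g) s c"
    proof (rule ex1I)
      show "decomposition T (carrier G) (\<lambda>g. \<phi> ` C g) s (\<lambda>g\<in>carrier G. \<phi> (c g))"
        unfolding s by (rule decomposition_hom[OF h.ring_hom_ring_axioms assms(2) CR c])
    next
      fix d assume d: "decomposition T (carrier G) (\<lambda>g. \<phi> ` C g) s d"
      have dT: "d g \<in> carrier T" if "g \<in> carrier G" for g
      proof -
        have "d g \<in> \<phi> ` C g" using d that by (auto simp: decomposition_def PiE_iff)
        then show ?thesis using CR[OF that] carrier_T by blast
      qed
      have "decomposition R (carrier G) (\<lambda>g. \<psi> ` \<phi> ` C g) (\<psi> s) (\<lambda>g\<in>carrier G. \<psi> (d g))"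
        by (rule decomposition_hom[OF k.ring_hom_ring_axioms inj\<psi> _ d]) (simp add: carrier_T CR image_mono)
      moreover have "\<psi> ` \<phi> ` C g = C g" if "g \<in> carrier G" for g
      proof -
        have "(\<lambda>x. \<psi> (\<phi> x)) ` C g = (\<lambda>x. x) ` C g"
          by (intro image_cong refl \<psi>\<phi>) (rule subsetD[OF CR[OF that]])
        then show ?thesis by (simp add: image_image)
      qed
      then have "(\<Pi>\<^sub>E g\<in>carrier G. \<psi> ` \<phi> ` C g) = (\<Pi>\<^sub>E g\<in>carrier G. C g)" by (rule PiE_cong)
      ultimately have "decomposition R (carrier G) C r (\<lambda>g\<in>carrier G. \<psi> (d g))"
        by (simp add: decomposition_def s \<psi>\<phi>[OF r])
      then have eq: "(\<lambda>g\<in>carrier G. \<psi> (d g)) = c" using ex1 c by blast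
      have "d \<in> extensional (carrier G)" using d by (simp add: decomposition_def PiE_def)
      then show "d = (\<lambda>g\<in>carrier G. \<phi> (c g))"
        using dT \<phi>\<psi> by (auto simp: fun_eq_iff extensional_def simp flip: eq)
    qed
  qed
  moreover have "generate (add_monoid T) (\<phi> ` C g <#>\<^bsub>T\<^esub> \<phi> ` C h) = \<phi> ` C (g \<otimes>\<^bsub>G\<^esub> h)"
    if g: "g \<in> carrier G" and h: "h \<in> carrier G" for g h
  proof -
    have "\<phi> x \<otimes>\<^bsub>T\<^esub> \<phi> y = \<phi> (x \<otimes>\<^bsub>R\<^esub> y)" if "x \<in> C g" "y \<in> C h" for x y
      using CR[OF g] CR[OF h] that by (simp add: subset_iff)
    then have "(\<Union>x\<in>C g. \<Union>y\<in>C h. {\<phi> x \<otimes>\<^bsub>T\<^esub> \<phi> y}) = (\<Union>x\<in>C g. \<Union>y\<in>C h. {\<phi> (x \<otimes>\<^bsub>R\<^esub> y)})"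
      by (intro SUP_cong refl) simp
    then have 1: "\<phi> ` C g <#>\<^bsub>T\<^esub> \<phi> ` C h = \<phi> ` (C g <#>\<^bsub>R\<^esub> C h)"
      by (simp add: set_mult_def image_UN)
    have 2: "C g <#>\<^bsub>R\<^esub> C h \<subseteq> carrier (add_monoid R)"
      using CR[OF g] CR[OF h] by (auto simp: set_mult_def subset_iff)
    show ?thesis
      unfolding 1 a.generate_img[OF 2] component_mult[OF g h] ..
  qed
  ultimately show ?thesis
    unfolding T_def[symmetric]
    by (intro strongly_graded_ring.intro strongly_graded_ring_axioms.intro T G.group_axioms)
qed

section \<open>The graded ring\<close>

lemma (in ring) finsum_mem_subgroup:
  assumes "subgroup H (add_monoid R)" "finite A" "\<And>a. a \<in> A \<Longrightarrow> f a \<in> H"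
  shows "finsum R f A \<in> H"
proof -
  have H: "H \<subseteq> carrier R" using subgroup.subset[OF assms(1)] by simp
  show ?thesis
    using assms(2,3)
  proof (induction A rule: finite_induct)
    case empty
    then show ?case using subgroup.one_closed[OF assms(1)] by simp
  next
    case (insert a A)
    have "finsum R f (insert a A) = f a \<oplus> finsum R f A"
      using insert H by (intro finsum_insert) (auto simp: subset_iff)
    then show ?case using subgroup.m_closed[OF assms(1), of "f a" "finsum R f A"] insert by simp
  qed
qed

text \<open>The ring $S_m[G] \times M_I(S_n)$, where $S_r$ is the ring \<open>cohn_ring r\<close> and $I$ consists of one index of
degree \<open>\<one>\<close> and of \<open>n\<close> indices of each other degree in $G$. Both factors are realised as blocks of
matrices indexed by pairs of a group element, the degree of the index, and a number: the indices
with second component \<open>0\<close> belong to $S_m[G]$, whose elements are the matrices indexed by $G$ that are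
invariant under left translation, and the other ones form $I$.\<close>

locale block_ring = group G for G :: "('g, 'h) monoid_scheme" (structure) +
  fixes m n :: nat
  assumes finite_G: "finite (carrier G)" and m_pos: "0 < m" and m_le_n: "m \<le> n"
begin

text \<open>The indices of both blocks; the only index \<open>(\<one>, i)\<close> with \<open>i > 0\<close> is \<open>(\<one>, 1)\<close>.\<close>

definition Idx :: "('g \<times> nat) set" where
  "Idx = {p. fst p \<in> carrier G \<and> snd p \<le> (if fst p = \<one> then 1 else n)}"

text \<open>The coefficient ring of the block of \<open>p\<close> is \<open>cohn_ring (level p)\<close>.\<close>

definition level :: "'g \<times> nat \<Rightarrow> nat" where "level p = (if snd p = 0 then m else n)"

text \<open>Both indices belong to the same block.\<close>

definition linked :: "'g \<times> nat \<Rightarrow> 'g \<times> nat \<Rightarrow> bool" where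
  "linked p q \<longleftrightarrow> p \<in> Idx \<and> q \<in> Idx \<and> (snd p = 0 \<longleftrightarrow> snd q = 0)"

text \<open>The elements of the ring: block diagonal matrices with reduced entries, translation invariant on
the block of the group ring.\<close>

definition block_mats :: "('g \<times> nat \<Rightarrow> 'g \<times> nat \<Rightarrow> elt) set" where
  "block_mats = {X. (\<forall>p q. \<not> linked p q \<longrightarrow> X p q = 0) \<and> (\<forall>p q. reduced (X p q)) \<and>
     (\<forall>g\<in>carrier G. \<forall>x\<in>carrier G. \<forall>y\<in>carrier G. X (g \<otimes> x, 0) (g \<otimes> y, 0) = X (x, 0) (y, 0))}"

definition mat_mul :: "('g \<times> nat \<Rightarrow> 'g \<times> nat \<Rightarrow> elt) \<Rightarrow> ('g \<times> nat \<Rightarrow> 'g \<times> nat \<Rightarrow> elt) \<Rightarrow>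
    'g \<times> nat \<Rightarrow> 'g \<times> nat \<Rightarrow> elt" where
  "mat_mul X Y p q = (\<Sum>r\<in>Idx. mul (level p) (X p r) (Y r q))"

definition block_alg :: "('g \<times> nat \<Rightarrow> 'g \<times> nat \<Rightarrow> elt) ring" where
  "block_alg = \<lparr>carrier = block_mats, mult = mat_mul, one = (\<lambda>p q. if p \<in> Idx \<and> p = q then mon [] else 0),
     zero = (\<lambda>p q. 0), add = (\<lambda>X Y p q. X p q + Y p q)\<rparr>"

text \<open>A matrix unit has degree \<open>g\<close> if its column index has the degree of its row index times \<open>g\<close>.\<close>

definition component :: "'g \<Rightarrow> ('g \<times> nat \<Rightarrow> 'g \<times> nat \<Rightarrow> elt) set" where
  "component g = {X \<in> block_mats. \<forall>p q. fst q \<noteq> fst p \<otimes> g \<longrightarrow> X p q = 0}"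

lemma block_alg_simps [simp]: "carrier block_alg = block_mats" "mult block_alg = mat_mul" "add block_alg = (\<lambda>X Y p q. X p q + Y p q)"
  "zero block_alg = (\<lambda>p q. 0)" "one block_alg = (\<lambda>p q. if p \<in> Idx \<and> p = q then mon [] else 0)"
  by (simp_all add: block_alg_def)

lemma block_matsI:
  assumes "\<And>p q. \<not> linked p q \<Longrightarrow> X p q = 0" "\<And>p q. reduced (X p q)"
    "\<And>g x y. g \<in> carrier G \<Longrightarrow> x \<in> carrier G \<Longrightarrow> y \<in> carrier G \<Longrightarrow>
      X (g \<otimes> x, 0) (g \<otimes> y, 0) = X (x, 0) (y, 0)"
  shows "X \<in> block_mats"
  using assms by (simp add: block_mats_def)

lemma block_mats_unlinked: "X \<in> block_mats \<Longrightarrow> \<not> linked p q \<Longrightarrow> X p q = 0"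
  and block_mats_reduced: "X \<in> block_mats \<Longrightarrow> reduced (X p q)"
  and block_mats_inv: "X \<in> block_mats \<Longrightarrow> g \<in> carrier G \<Longrightarrow> x \<in> carrier G \<Longrightarrow> y \<in> carrier G \<Longrightarrow>
      X (g \<otimes> x, 0) (g \<otimes> y, 0) = X (x, 0) (y, 0)"
  unfolding block_mats_def by blast+

lemma finite_Idx: "finite Idx"
proof (rule finite_subset)
  show "Idx \<subseteq> carrier G \<times> {..max 1 n}" by (auto simp: Idx_def split: if_splits)
  show "finite (carrier G \<times> {..max 1 n})" using finite_G by simp
qed

lemma Idx_0 [simp]: "(x, 0) \<in> Idx \<longleftrightarrow> x \<in> carrier G" by (simp add: Idx_def)

lemma Idx_fst: "p \<in> Idx \<Longrightarrow> fst p \<in> carrier G" by (simp add: Idx_def)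

lemma mat_mul_0:
  assumes "X \<in> block_mats"
  shows "mat_mul X Y (x, 0) q = (\<Sum>z\<in>carrier G. mul m (X (x, 0) (z, 0)) (Y (z, 0) q))"
proof -
  have "mat_mul X Y (x, 0) q = (\<Sum>r\<in>(\<lambda>z. (z, 0)) ` carrier G. mul m (X (x, 0) r) (Y r q))"
    unfolding mat_mul_def
  proof (rule sum.mono_neutral_cong_right[OF finite_Idx])
    show "(\<lambda>z. (z, 0)) ` carrier G \<subseteq> Idx" by auto
    show "\<forall>r\<in>Idx - (\<lambda>z. (z, 0)) ` carrier G. mul (level (x, 0)) (X (x, 0) r) (Y r q) = 0"
    proof
      fix r assume r: "r \<in> Idx - (\<lambda>z. (z, 0)) ` carrier G"
      then have "snd r \<noteq> 0" by (cases r) auto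
      then have "X (x, 0) r = 0" by (intro block_mats_unlinked[OF assms]) (simp add: linked_def)
      then show "mul (level (x, 0)) (X (x, 0) r) (Y r q) = 0" by simp
    qed
  qed (simp add: level_def)
  also have "\<dots> = (\<Sum>z\<in>carrier G. mul m (X (x, 0) (z, 0)) (Y (z, 0) q))"
    by (subst sum.reindex) (auto simp: inj_on_def)
  finally show ?thesis .
qed

lemma bij_left_mult: "g \<in> carrier G \<Longrightarrow> bij_betw (\<lambda>z. g \<otimes> z) (carrier G) (carrier G)"
  by (rule bij_betw_byWitness[where f' = "\<lambda>z. inv g \<otimes> z"]) (auto simp: m_assoc[symmetric])

lemma mat_mul_closed:
  assumes X: "X \<in> block_mats" and Y: "Y \<in> block_mats"
  shows "mat_mul X Y \<in> block_mats"
proof (rule block_matsI)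
  fix p q assume pq: "\<not> linked p q"
  have "mul (level p) (X p r) (Y r q) = 0" for r
  proof (cases "linked p r")
    case True
    then have "\<not> linked r q" using pq by (auto simp: linked_def)
    then show ?thesis by (simp add: block_mats_unlinked[OF Y])
  qed (simp add: block_mats_unlinked[OF X])
  then show "mat_mul X Y p q = 0" by (simp add: mat_mul_def)
next
  fix p q show "reduced (mat_mul X Y p q)" unfolding mat_mul_def by (intro reduced_sum reduced_mul block_mats_reduced X)
next
  fix g x y assume g: "g \<in> carrier G" and x: "x \<in> carrier G" and y: "y \<in> carrier G"
  have "mat_mul X Y (g \<otimes> x, 0) (g \<otimes> y, 0) =
      (\<Sum>z\<in>carrier G. mul m (X (g \<otimes> x, 0) (g \<otimes> z, 0)) (Y (g \<otimes> z, 0) (g \<otimes> y, 0)))"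
    unfolding mat_mul_0[OF X] by (rule sum.reindex_bij_betw[OF bij_left_mult[OF g], symmetric])
  also have "\<dots> = mat_mul X Y (x, 0) (y, 0)"
    unfolding mat_mul_0[OF X] by (intro sum.cong refl) (simp add: block_mats_inv[OF X] block_mats_inv[OF Y] g x y)
  finally show "mat_mul X Y (g \<otimes> x, 0) (g \<otimes> y, 0) = mat_mul X Y (x, 0) (y, 0)" .
qed

lemma level_linked: "X \<in> block_mats \<Longrightarrow> X p r \<noteq> 0 \<Longrightarrow> level r = level p"
  using block_mats_unlinked[of X p r] by (auto simp: linked_def level_def)

lemma mat_mul_assoc:
  assumes "X \<in> block_mats"
  shows "mat_mul (mat_mul X Y) Z = mat_mul X (mat_mul Y Z)"
proof (intro ext)
  fix p q
  have "mat_mul X (mat_mul Y Z) p q = (\<Sum>r\<in>Idx. mul (level p) (X p r) (\<Sum>s\<in>Idx. mul (level p) (Y r s) (Z s q)))"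
    unfolding mat_mul_def
  proof (rule sum.cong[OF refl])
    fix r show "mul (level p) (X p r) (\<Sum>s\<in>Idx. mul (level r) (Y r s) (Z s q)) =
        mul (level p) (X p r) (\<Sum>s\<in>Idx. mul (level p) (Y r s) (Z s q))"
      by (cases "X p r = 0") (simp_all add: level_linked[OF assms])
  qed
  also have "\<dots> = (\<Sum>r\<in>Idx. \<Sum>s\<in>Idx. mul (level p) (mul (level p) (X p r) (Y r s)) (Z s q))"
    by (simp only: mul_sum_right mul_assoc)
  also have "\<dots> = (\<Sum>s\<in>Idx. \<Sum>r\<in>Idx. mul (level p) (mul (level p) (X p r) (Y r s)) (Z s q))"
    by (rule sum.swap)
  also have "\<dots> = mat_mul (mat_mul X Y) Z p q" by (simp only: mat_mul_def mul_sum_left)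
  finally show "mat_mul (mat_mul X Y) Z p q = mat_mul X (mat_mul Y Z) p q" ..
qed

lemma mat_mul_row_unit_mat:
  assumes "a \<in> Idx" "\<And>r. r \<in> Idx \<Longrightarrow> U p r = (if r = a then mon [] else 0)" "reduced (Y a q)"
  shows "mat_mul U Y p q = Y a q"
proof -
  have "mat_mul U Y p q = (\<Sum>r\<in>Idx. if r = a then mul (level p) (mon []) (Y a q) else 0)"
    unfolding mat_mul_def by (rule sum.cong) (simp_all add: assms(2))
  also have "\<dots> = Y a q" using assms(1) finite_Idx mul_one_left[OF assms(3)] by simp
  finally show ?thesis .
qed

lemma mat_mul_row_0: "(\<And>r. r \<in> Idx \<Longrightarrow> U p r = 0) \<Longrightarrow> mat_mul U Y p q = 0"
  by (simp add: mat_mul_def)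

lemma one_block_mats: "(\<lambda>p q. if p \<in> Idx \<and> p = q then mon [] else 0) \<in> block_mats"
  by (rule block_matsI) (auto simp: linked_def)

lemma ring_block_alg: "ring block_alg"
proof (intro ringI abelian_groupI monoidI)
  fix X Y assume X: "X \<in> carrier block_alg" and Y: "Y \<in> carrier block_alg"
  show "X \<oplus>\<^bsub>block_alg\<^esub> Y \<in> carrier block_alg"
    using X Y by (auto intro!: block_matsI simp: block_mats_unlinked block_mats_inv intro: reduced_add block_mats_reduced)
  show "X \<otimes>\<^bsub>block_alg\<^esub> Y \<in> carrier block_alg" using X Y by (simp add: mat_mul_closed)
  show "X \<oplus>\<^bsub>block_alg\<^esub> Y = Y \<oplus>\<^bsub>block_alg\<^esub> X" by (simp add: add.commute)
  fix Z assume Z: "Z \<in> carrier block_alg"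
  show "X \<oplus>\<^bsub>block_alg\<^esub> Y \<oplus>\<^bsub>block_alg\<^esub> Z = X \<oplus>\<^bsub>block_alg\<^esub> (Y \<oplus>\<^bsub>block_alg\<^esub> Z)" by (simp add: add.assoc)
  show "X \<otimes>\<^bsub>block_alg\<^esub> Y \<otimes>\<^bsub>block_alg\<^esub> Z = X \<otimes>\<^bsub>block_alg\<^esub> (Y \<otimes>\<^bsub>block_alg\<^esub> Z)" using X by (simp add: mat_mul_assoc)
  show "(X \<oplus>\<^bsub>block_alg\<^esub> Y) \<otimes>\<^bsub>block_alg\<^esub> Z = X \<otimes>\<^bsub>block_alg\<^esub> Z \<oplus>\<^bsub>block_alg\<^esub> Y \<otimes>\<^bsub>block_alg\<^esub> Z"
    by (simp add: mat_mul_def fun_eq_iff mul_add_left sum.distrib)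
  show "Z \<otimes>\<^bsub>block_alg\<^esub> (X \<oplus>\<^bsub>block_alg\<^esub> Y) = Z \<otimes>\<^bsub>block_alg\<^esub> X \<oplus>\<^bsub>block_alg\<^esub> Z \<otimes>\<^bsub>block_alg\<^esub> Y"
    by (simp add: mat_mul_def fun_eq_iff mul_add_right sum.distrib)
next
  show "\<zero>\<^bsub>block_alg\<^esub> \<in> carrier block_alg" by (simp add: block_mats_def)
  show "\<one>\<^bsub>block_alg\<^esub> \<in> carrier block_alg" using one_block_mats by simp
next
  fix X assume X: "X \<in> carrier block_alg"
  then have XB: "X \<in> block_mats" by simp
  show "\<zero>\<^bsub>block_alg\<^esub> \<oplus>\<^bsub>block_alg\<^esub> X = X" by simp
  show "\<exists>Y\<in>carrier block_alg. Y \<oplus>\<^bsub>block_alg\<^esub> X = \<zero>\<^bsub>block_alg\<^esub>" using X by (intro bexI[of _ X]) auto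
  show "\<one>\<^bsub>block_alg\<^esub> \<otimes>\<^bsub>block_alg\<^esub> X = X"
  proof (intro ext)
    fix p q show "(\<one>\<^bsub>block_alg\<^esub> \<otimes>\<^bsub>block_alg\<^esub> X) p q = X p q"
    proof (cases "p \<in> Idx")
      case True
      then show ?thesis using mat_mul_row_unit_mat[of p "\<one>\<^bsub>block_alg\<^esub>" p X q] block_mats_reduced[OF XB] by auto
    next
      case False
      then have "X p q = 0" by (intro block_mats_unlinked[OF XB]) (simp add: linked_def)
      then show ?thesis using mat_mul_row_0[of "\<one>\<^bsub>block_alg\<^esub>" p X q] False by simp
    qed
  qed
  show "X \<otimes>\<^bsub>block_alg\<^esub> \<one>\<^bsub>block_alg\<^esub> = X"
  proof (intro ext)
    fix p q
    have "(X \<otimes>\<^bsub>block_alg\<^esub> \<one>\<^bsub>block_alg\<^esub>) p q = (\<Sum>r\<in>Idx. if r = q then X p r else 0)"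
      unfolding block_alg_simps mat_mul_def by (rule sum.cong) auto
    also have "\<dots> = X p q"
      using finite_Idx block_mats_unlinked[OF XB, of p q] by (auto simp: linked_def)
    finally show "(X \<otimes>\<^bsub>block_alg\<^esub> \<one>\<^bsub>block_alg\<^esub>) p q = X p q" .
  qed
qed

lemma block_alg_finsum_entry:
  assumes "finite A" "\<And>a. a \<in> A \<Longrightarrow> f a \<in> block_mats"
  shows "finsum block_alg f A p q = (\<Sum>a\<in>A. f a p q)"
  using assms
proof (induction A rule: finite_induct)
  case empty
  interpret R: ring block_alg by (rule ring_block_alg)
  show ?case by simp
next
  case (insert a A)
  interpret R: ring block_alg by (rule ring_block_alg)
  have "finsum block_alg f (insert a A) = f a \<oplus>\<^bsub>block_alg\<^esub> finsum block_alg f A"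
    using insert by (intro R.finsum_insert) auto
  then show ?case using insert by simp
qed

lemma componentD: "X \<in> component g \<Longrightarrow> X \<in> block_mats" "X \<in> component g \<Longrightarrow> fst q \<noteq> fst p \<otimes> g \<Longrightarrow> X p q = 0"
  unfolding component_def by blast+

lemma componentI: "X \<in> block_mats \<Longrightarrow> (\<And>p q. X p q \<noteq> 0 \<Longrightarrow> fst q = fst p \<otimes> g) \<Longrightarrow> X \<in> component g"
  unfolding component_def by blast

lemma component_subgroup: "subgroup (component g) (add_monoid block_alg)"
proof -
  interpret R: ring block_alg by (rule ring_block_alg)
  show ?thesis
  proof (rule R.add.subgroupI)
    show "component g \<subseteq> carrier block_alg" by (auto simp: component_def)
    have "(\<lambda>p q. 0) \<in> component g" by (simp add: component_def block_mats_def)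
    then show "component g \<noteq> {}" by blast
    fix X assume X: "X \<in> component g"
    have "\<ominus>\<^bsub>block_alg\<^esub> X = X"
      by (rule R.minus_equality) (use componentD(1)[OF X] in simp_all)
    then show "\<ominus>\<^bsub>block_alg\<^esub> X \<in> component g" using X by simp
    fix Y assume Y: "Y \<in> component g"
    have "X \<oplus>\<^bsub>block_alg\<^esub> Y \<in> block_mats"
      using R.a_closed[of X Y] componentD(1)[OF X] componentD(1)[OF Y] by simp
    then show "X \<oplus>\<^bsub>block_alg\<^esub> Y \<in> component g"
      using X Y by (simp add: component_def)
  qed
qed

lemma linked_solve:
  assumes "linked p q" "g \<in> carrier G"
  shows "fst q = fst p \<otimes> g \<longleftrightarrow> g = inv (fst p) \<otimes> fst q"
proof -
  have "fst p \<in> carrier G" "fst q \<in> carrier G"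
    using assms(1) Idx_fst by (auto simp: linked_def)
  then show ?thesis using assms(2) by (metis inv_solve_left)
qed

lemma component_sum_entry:
  assumes c: "c \<in> (\<Pi>\<^sub>E g\<in>carrier G. component g)"
  shows "finsum block_alg c {g \<in> carrier G. c g \<noteq> \<zero>\<^bsub>block_alg\<^esub>} p q =
    (if linked p q then c (inv (fst p) \<otimes> fst q) p q else 0)"
proof -
  have cC: "c g \<in> component g" if "g \<in> carrier G" for g using c that by (auto simp: PiE_iff)
  have cB: "c g \<in> block_mats" if "g \<in> carrier G" for g using componentD(1)[OF cC[OF that]] .
  have "finsum block_alg c {g \<in> carrier G. c g \<noteq> \<zero>\<^bsub>block_alg\<^esub>} p q = (\<Sum>g\<in>{g \<in> carrier G. c g \<noteq> \<zero>\<^bsub>block_alg\<^esub>}. c g p q)"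
    using finite_G cB by (intro block_alg_finsum_entry) auto
  also have "\<dots> = (\<Sum>g\<in>carrier G. c g p q)"
    using finite_G by (intro sum.mono_neutral_left) auto
  also have "\<dots> = (if linked p q then c (inv (fst p) \<otimes> fst q) p q else 0)"
  proof (cases "linked p q")
    case True
    let ?g = "inv (fst p) \<otimes> fst q"
    have g: "?g \<in> carrier G" using True Idx_fst by (auto simp: linked_def)
    have "(\<Sum>g\<in>carrier G. c g p q) = (\<Sum>g\<in>{?g}. c g p q)"
    proof (rule sum.mono_neutral_right[OF finite_G])
      show "\<forall>h\<in>carrier G - {?g}. c h p q = 0"
        using componentD(2)[OF cC] linked_solve[OF True] by blast
    qed (use g in simp)
    then show ?thesis using True by simp
  next
    case False
    then show ?thesis using block_mats_unlinked[OF cB False] by simp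
  qed
  finally show ?thesis .
qed

lemma block_alg_direct_sum: "additive_direct_sum block_alg (carrier G) component"
  unfolding additive_direct_sum_def
proof (intro conjI ballI)
  fix g show "additive_subgroup (component g) block_alg" by (rule additive_subgroup.intro[OF component_subgroup])
next
  fix X assume "X \<in> carrier block_alg"
  then have X: "X \<in> block_mats" by simp
  define c where "c = (\<lambda>g\<in>carrier G. \<lambda>p q. if fst q = fst p \<otimes> g then X p q else 0)"
  have c: "c \<in> (\<Pi>\<^sub>E g\<in>carrier G. component g)"
    unfolding c_def
  proof (rule restrict_PiE_iff[THEN iffD2], intro ballI componentI block_matsI)
    fix g h x y assume g: "g \<in> carrier G" and *: "h \<in> carrier G" "x \<in> carrier G" "y \<in> carrier G"
    have "h \<otimes> y = h \<otimes> x \<otimes> g \<longleftrightarrow> y = x \<otimes> g" using g * by (simp add: m_assoc)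
    then show "(if fst (h \<otimes> y, 0) = fst (h \<otimes> x, 0) \<otimes> g then X (h \<otimes> x, 0) (h \<otimes> y, 0) else 0) =
        (if fst (y, 0) = fst (x, 0) \<otimes> g then X (x, 0) (y, 0) else 0)"
      using block_mats_inv[OF X *] by (cases "y = x \<otimes> g") simp_all
  qed (auto simp: block_mats_unlinked[OF X] block_mats_reduced[OF X] split: if_splits)
  have entry: "c (inv (fst p) \<otimes> fst q) p q = X p q" if "linked p q" for p q
  proof -
    have g: "inv (fst p) \<otimes> fst q \<in> carrier G" using that Idx_fst by (auto simp: linked_def)
    then show ?thesis using linked_solve[OF that g] by (simp add: c_def)
  qed
  show "\<exists>!c. c \<in> (\<Pi>\<^sub>E g\<in>carrier G. component g) \<and> finite {g \<in> carrier G. c g \<noteq> \<zero>\<^bsub>block_alg\<^esub>} \<and>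
      X = finsum block_alg c {g \<in> carrier G. c g \<noteq> \<zero>\<^bsub>block_alg\<^esub>}"
  proof (rule ex1I, intro conjI)
    show "c \<in> (\<Pi>\<^sub>E g\<in>carrier G. component g)" by (rule c)
    show "finite {g \<in> carrier G. c g \<noteq> \<zero>\<^bsub>block_alg\<^esub>}" using finite_G by simp
    show "X = finsum block_alg c {g \<in> carrier G. c g \<noteq> \<zero>\<^bsub>block_alg\<^esub>}"
    proof (intro ext)
      fix p q
      show "X p q = finsum block_alg c {g \<in> carrier G. c g \<noteq> \<zero>\<^bsub>block_alg\<^esub>} p q"
        unfolding component_sum_entry[OF c] using entry[of p q] block_mats_unlinked[OF X, of p q] by simp
    qed
  next
    fix d assume d: "d \<in> (\<Pi>\<^sub>E g\<in>carrier G. component g) \<and> finite {g \<in> carrier G. d g \<noteq> \<zero>\<^bsub>block_alg\<^esub>} \<and>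
      X = finsum block_alg d {g \<in> carrier G. d g \<noteq> \<zero>\<^bsub>block_alg\<^esub>}"
    have X_d: "X p q = d (inv (fst p) \<otimes> fst q) p q" if "linked p q" for p q
      using component_sum_entry[of d p q] d that by metis
    have "d g = c g" if g: "g \<in> carrier G" for g
    proof (intro ext)
      fix p q
      have dC: "d g \<in> component g" and cC: "c g \<in> component g" using d c g by (auto simp: PiE_iff)
      show "d g p q = c g p q"
      proof (cases "linked p q \<and> fst q = fst p \<otimes> g")
        case True
        then show ?thesis using X_d entry linked_solve g by metis
      next
        case False
        then show ?thesis
          using componentD(2)[OF dC] componentD(2)[OF cC] block_mats_unlinked[OF componentD(1)[OF dC]]
            block_mats_unlinked[OF componentD(1)[OF cC]] by metis
      qed
    qed
    then show "d = c" using d c by (intro PiE_ext) auto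
  qed
qed

lemma mat_mul_component:
  assumes "X \<in> component g" "Y \<in> component h" "g \<in> carrier G" "h \<in> carrier G"
  shows "mat_mul X Y \<in> component (g \<otimes> h)"
proof (rule componentI[OF mat_mul_closed[OF componentD(1)[OF assms(1)] componentD(1)[OF assms(2)]]])
  fix p q assume "mat_mul X Y p q \<noteq> 0"
  then obtain r where "r \<in> Idx" and r: "mul (level p) (X p r) (Y r q) \<noteq> 0"
    unfolding mat_mul_def by (meson sum.not_neutral_contains_not_neutral)
  then have *: "X p r \<noteq> 0" "Y r q \<noteq> 0" by auto
  then have "p \<in> Idx" using block_mats_unlinked[OF componentD(1)[OF assms(1)], of p r] by (auto simp: linked_def)
  moreover have "fst r = fst p \<otimes> g" "fst q = fst r \<otimes> h"
    using * componentD(2)[OF assms(1)] componentD(2)[OF assms(2)] by blast+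
  ultimately show "fst q = fst p \<otimes> (g \<otimes> h)" using assms(3,4) Idx_fst by (simp add: m_assoc)
qed

text \<open>The element \<open>g\<close> of the group ring $S_m[G]$.\<close>

definition shift_mat :: "'g \<Rightarrow> 'g \<times> nat \<Rightarrow> 'g \<times> nat \<Rightarrow> elt" where
  "shift_mat g p q = (if p \<in> Idx \<and> snd p = 0 \<and> q = (fst p \<otimes> g, 0) then mon [] else 0)"

text \<open>The matrix unit with entry one in row \<open>a\<close> and column \<open>b\<close>.\<close>

definition unit_mat :: "'g \<times> nat \<Rightarrow> 'g \<times> nat \<Rightarrow> 'g \<times> nat \<Rightarrow> 'g \<times> nat \<Rightarrow> elt" where
  "unit_mat a b p q = (if p = a \<and> q = b then mon [] else 0)"

lemma shift_mat_component: assumes "g \<in> carrier G" shows "shift_mat g \<in> component g"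
proof (intro componentI block_matsI)
  fix h x y assume *: "h \<in> carrier G" "x \<in> carrier G" "y \<in> carrier G"
  have "h \<otimes> y = h \<otimes> x \<otimes> g \<longleftrightarrow> y = x \<otimes> g" using assms * by (simp add: m_assoc)
  then show "shift_mat g (h \<otimes> x, 0) (h \<otimes> y, 0) = shift_mat g (x, 0) (y, 0)"
    using * by (simp add: shift_mat_def)
qed (use assms Idx_fst in \<open>auto simp: shift_mat_def linked_def split: if_splits\<close>)

lemma unit_mat_component:
  assumes "a \<in> Idx" "b \<in> Idx" "snd a \<noteq> 0" "snd b \<noteq> 0" "fst b = fst a \<otimes> g"
  shows "unit_mat a b \<in> component g"
proof (intro componentI block_matsI)
  fix h x y show "unit_mat a b (h \<otimes> x, 0) (h \<otimes> y, 0) = unit_mat a b (x, 0) (y, 0)"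
    using assms(3) by (auto simp: unit_mat_def)
qed (use assms in \<open>auto simp: unit_mat_def linked_def split: if_splits\<close>)

lemma mat_mul_unit_mat:
  assumes "b \<in> Idx" "X \<in> block_mats"
  shows "mat_mul (unit_mat a b) X p q = (if p = a then X b q else 0)"
  using mat_mul_row_unit_mat[of b "unit_mat a b" p X q] mat_mul_row_0[of "unit_mat a b" p X q] block_mats_reduced[OF assms(2)] assms(1)
  by (auto simp: unit_mat_def)

lemma mat_mul_shift_mat:
  assumes "g \<in> carrier G" "X \<in> block_mats"
  shows "mat_mul (shift_mat g) X p q = (if p \<in> Idx \<and> snd p = 0 then X (fst p \<otimes> g, 0) q else 0)"
  using mat_mul_row_unit_mat[of "(fst p \<otimes> g, 0)" "shift_mat g" p X q] mat_mul_row_0[of "shift_mat g" p X q]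
    block_mats_reduced[OF assms(2)] assms(1) Idx_fst
  by (auto simp: shift_mat_def)

text \<open>Every \<open>X\<close> of degree \<open>g \<otimes> h\<close> is \<open>1 X\<close>, where the identity matrix is a sum of products of elements
of degree \<open>g\<close> and \<open>inv g\<close>: on the group ring, of \<open>g\<close> and its inverse; on the other block, of matrix
units $e_{pb}$ and $e_{bp}$ for the indices \<open>p\<close>, where \<open>b\<close> is an index of degree \<open>fst p \<otimes> g\<close>.\<close>

lemma component_mult_generate:
  assumes g: "g \<in> carrier G" and h: "h \<in> carrier G"
  shows "generate (add_monoid block_alg) (component g <#>\<^bsub>block_alg\<^esub> component h) = component (g \<otimes> h)"
proof -
  interpret R: ring block_alg by (rule ring_block_alg)
  let ?S = "component g <#>\<^bsub>block_alg\<^esub> component h"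
  have S: "?S \<subseteq> component (g \<otimes> h)" using mat_mul_component g h by (auto simp: set_mult_def)
  have S': "?S \<subseteq> carrier block_alg" using S componentD(1) by auto
  have gen: "subgroup (generate (add_monoid block_alg) ?S) (add_monoid block_alg)"
    by (rule R.add.generate_is_subgroup[OF S'])
  have incl: "mat_mul X Y \<in> generate (add_monoid block_alg) ?S" if "X \<in> component g" "Y \<in> component h" for X Y
    using that by (intro generate.incl) (auto simp: set_mult_def)
  show ?thesis
  proof
    show "generate (add_monoid block_alg) ?S \<subseteq> component (g \<otimes> h)"
      by (rule R.add.generate_subgroup_incl[OF S component_subgroup])
    show "component (g \<otimes> h) \<subseteq> generate (add_monoid block_alg) ?S"
    proof
      fix X assume X: "X \<in> component (g \<otimes> h)"
      note XB = componentD(1)[OF X]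
      have vX: "mat_mul V X \<in> component h" if "V \<in> component (inv g)" for V
        using mat_mul_component[OF that X] g h by (simp add: m_assoc[symmetric])
      define K where "K = {p \<in> Idx. snd p \<noteq> 0}"
      define b where "b p = (fst p \<otimes> g, 1 :: nat)" for p :: "'g \<times> nat"
      have b: "b p \<in> Idx" "snd (b p) \<noteq> 0" if "p \<in> K" for p
        using that g m_pos m_le_n by (auto simp: b_def K_def Idx_def)
      have u: "unit_mat p (b p) \<in> component g" "unit_mat (b p) p \<in> component (inv g)" if p: "p \<in> K" for p
        using p b[OF p] g Idx_fst[of p]
        by (auto intro!: unit_mat_component simp: K_def b_def m_assoc)
      define Z where "Z p = mat_mul (unit_mat p (b p)) (mat_mul (unit_mat (b p) p) X)" for p
      define Z0 where "Z0 = mat_mul (shift_mat g) (mat_mul (shift_mat (inv g)) X)"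
      have Z: "Z p \<in> generate (add_monoid block_alg) ?S" if "p \<in> K" for p
        unfolding Z_def by (intro incl vX u that)
      have Z0: "Z0 \<in> generate (add_monoid block_alg) ?S"
        unfolding Z0_def by (intro incl vX shift_mat_component inv_closed g)
      have mats_gen: "Y \<in> block_mats" if "Y \<in> generate (add_monoid block_alg) ?S" for Y
        using subgroup.subset[OF gen] that by auto
      have finK: "finite K" using finite_Idx by (simp add: K_def)
      have "X = Z0 \<oplus>\<^bsub>block_alg\<^esub> finsum block_alg Z K"
      proof (intro ext)
        fix p q
        have Zpq: "Z s p q = (if p = s then X p q else 0)" if s: "s \<in> K" for s
          unfolding Z_def
          using mat_mul_unit_mat[OF b(1)[OF s] componentD(1)[OF vX[OF u(2)[OF s]]]] mat_mul_unit_mat[of s X "b s" "b s" q] s XB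
          by (simp add: K_def)
        have Z0pq: "Z0 p q = (if p \<in> Idx \<and> snd p = 0 then X p q else 0)"
        proof (cases "p \<in> Idx \<and> snd p = 0")
          case True
          then have "fst p \<in> carrier G" and p: "p = (fst p, 0)" using Idx_fst by (auto simp: prod_eq_iff)
          then have "mat_mul (shift_mat (inv g)) X (fst p \<otimes> g, 0) q = X p q"
            using mat_mul_shift_mat[of "inv g" X "(fst p \<otimes> g, 0)" q] XB g by (simp add: m_assoc)
          then show ?thesis
            using True mat_mul_shift_mat[OF g componentD(1)[OF vX[OF shift_mat_component[OF inv_closed[OF g]]]], of p q]
            by (simp add: Z0_def)
        next
          case False
          then show ?thesis
            using mat_mul_shift_mat[OF g componentD(1)[OF vX[OF shift_mat_component[OF inv_closed[OF g]]]], of p q]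
            by (auto simp: Z0_def)
        qed
        have "(Z0 \<oplus>\<^bsub>block_alg\<^esub> finsum block_alg Z K) p q = Z0 p q + (\<Sum>s\<in>K. Z s p q)"
          using block_alg_finsum_entry[OF finK, of Z p q] mats_gen Z by simp
        also have "(\<Sum>s\<in>K. Z s p q) = (\<Sum>s\<in>K. if p = s then X p q else 0)"
          by (intro sum.cong refl Zpq)
        also have "\<dots> = (if p \<in> K then X p q else 0)" using finK by simp
        also have "Z0 p q + \<dots> = X p q"
          using block_mats_unlinked[OF XB, of p q] by (auto simp: Z0pq K_def linked_def)
        finally show "X p q = (Z0 \<oplus>\<^bsub>block_alg\<^esub> finsum block_alg Z K) p q" ..
      qed
      moreover have "finsum block_alg Z K \<in> generate (add_monoid block_alg) ?S"
        by (rule R.finsum_mem_subgroup[OF gen finK Z])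
      ultimately show "X \<in> generate (add_monoid block_alg) ?S"
        using subgroup.m_closed[OF gen Z0] by simp
    qed
  qed
qed

lemma strongly_graded_block_alg: "strongly_graded_ring block_alg G component"
  by (intro strongly_graded_ring.intro strongly_graded_ring_axioms.intro ring_block_alg
      group_axioms block_alg_direct_sum component_mult_generate)

end

section \<open>Generating numbers of the graded ring and of its base ring\<close>

instance letter :: countable
  by countable_datatype

lemma elt_keys_eqI: "keys x = keys y \<Longrightarrow> (x :: elt) = y"
  using elt_eq_sum[of x] elt_eq_sum[of y] by simp

context block_ring
begin

lemma countable_block_mats: "countable block_mats"
proof -
  define f where "f X = (SIGMA r:Idx \<times> Idx. keys (X (fst r) (snd r)))" for X :: "'g \<times> nat \<Rightarrow> 'g \<times> nat \<Rightarrow> elt"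
  let ?T = "(Idx \<times> Idx) \<times> (UNIV :: word set)"
  have "countable ?T"
    by (intro countable_SIGMA countableI_type countable_finite finite_cartesian_product finite_Idx)
  then have "countable {A. A \<subseteq> ?T \<and> finite A}"
    using countable_Collect_finite_subset[of ?T] by (simp add: conj_commute)
  moreover have "f ` block_mats \<subseteq> {A. A \<subseteq> ?T \<and> finite A}"
    unfolding f_def using finite_Idx by (intro image_subsetI CollectI conjI finite_SigmaI) auto
  ultimately have "countable (f ` block_mats)" by (rule countable_subset[rotated])
  moreover have "inj_on f block_mats"
  proof (rule inj_onI, intro ext)
    fix X Y p q assume X: "X \<in> block_mats" and Y: "Y \<in> block_mats" and eq: "f X = f Y"
    show "X p q = Y p q"
    proof (cases "linked p q")
      case True
      then have pq: "(p, q) \<in> Idx \<times> Idx" by (simp add: linked_def)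
      have "keys (Z p q) = f Z `` {(p, q)}" for Z using pq by (simp add: f_def Sigma_Image)
      then show ?thesis using eq by (intro elt_keys_eqI) simp
    next
      case False
      then show ?thesis using block_mats_unlinked[OF X] block_mats_unlinked[OF Y] by simp
    qed
  qed
  ultimately show ?thesis by (rule countable_image_inj_on)
qed

lemma subring_component_one: "subring (component \<one>) block_alg"
proof -
  interpret R: ring block_alg by (rule ring_block_alg)
  show ?thesis
  proof (rule R.subringI)
    show "component \<one> \<subseteq> carrier block_alg" using componentD(1) by auto
    show "\<one>\<^bsub>block_alg\<^esub> \<in> component \<one>"
      unfolding block_alg_simps by (rule componentI[OF one_block_mats]) (simp add: Idx_fst split: if_splits)
    show "\<ominus>\<^bsub>block_alg\<^esub> X \<in> component \<one>" if "X \<in> component \<one>" for X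
      using subgroup.m_inv_closed[OF component_subgroup, of X \<one>] that by (simp add: a_inv_def)
    show "X \<otimes>\<^bsub>block_alg\<^esub> Y \<in> component \<one>" if "X \<in> component \<one>" "Y \<in> component \<one>" for X Y
      using mat_mul_component[OF that] by simp
    show "X \<oplus>\<^bsub>block_alg\<^esub> Y \<in> component \<one>" if "X \<in> component \<one>" "Y \<in> component \<one>" for X Y
      using subgroup.m_closed[OF component_subgroup that] by simp
  qed
qed

text \<open>The base ring.\<close>

abbreviation block_alg1 :: "('g \<times> nat \<Rightarrow> 'g \<times> nat \<Rightarrow> elt) ring" where
  "block_alg1 \<equiv> block_alg\<lparr>carrier := component \<one>\<rparr>"

lemma ring_block_alg1: "ring block_alg1"
  by (rule ring.subring_is_ring[OF ring_block_alg subring_component_one])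

text \<open>The augmentation of the group ring $S_m[G]$, with the row of \<open>\<one>\<close> as the list of coefficients.\<close>

lemma augmentation_hom: "(\<lambda>X. \<Sum>y\<in>carrier G. X (\<one>, 0) (y, 0)) \<in> ring_hom block_alg (cohn_ring m)"
proof (rule ring_hom_memI)
  fix X assume "X \<in> carrier block_alg"
  then have X: "X \<in> block_mats" by simp
  show "(\<Sum>y\<in>carrier G. X (\<one>, 0) (y, 0)) \<in> carrier (cohn_ring m)"
    using block_mats_reduced[OF X] by (simp add: reduced_sum)
  fix Y assume "Y \<in> carrier block_alg"
  then have Y: "Y \<in> block_mats" by simp
  have Yrow: "(\<Sum>y\<in>carrier G. Y (z, 0) (y, 0)) = (\<Sum>y\<in>carrier G. Y (\<one>, 0) (y, 0))"
    if z: "z \<in> carrier G" for z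
  proof -
    have "(\<Sum>y\<in>carrier G. Y (z, 0) (y, 0)) = (\<Sum>y\<in>carrier G. Y (z, 0) (z \<otimes> y, 0))"
      by (rule sum.reindex_bij_betw[OF bij_left_mult[OF z], symmetric])
    also have "\<dots> = (\<Sum>y\<in>carrier G. Y (\<one>, 0) (y, 0))"
      using block_mats_inv[OF Y z one_closed] z by (intro sum.cong refl) simp
    finally show ?thesis .
  qed
  have "(\<Sum>y\<in>carrier G. mat_mul X Y (\<one>, 0) (y, 0)) =
      (\<Sum>z\<in>carrier G. \<Sum>y\<in>carrier G. mul m (X (\<one>, 0) (z, 0)) (Y (z, 0) (y, 0)))"
    unfolding mat_mul_0[OF X] by (rule sum.swap)
  also have "\<dots> = (\<Sum>z\<in>carrier G. mul m (X (\<one>, 0) (z, 0)) (\<Sum>y\<in>carrier G. Y (\<one>, 0) (y, 0)))"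
    by (intro sum.cong refl) (simp only: mul_sum_right[symmetric] Yrow)
  also have "\<dots> = mul m (\<Sum>z\<in>carrier G. X (\<one>, 0) (z, 0)) (\<Sum>y\<in>carrier G. Y (\<one>, 0) (y, 0))"
    by (rule mul_sum_left[symmetric])
  finally show "(\<Sum>y\<in>carrier G. (X \<otimes>\<^bsub>block_alg\<^esub> Y) (\<one>, 0) (y, 0)) =
      (\<Sum>y\<in>carrier G. X (\<one>, 0) (y, 0)) \<otimes>\<^bsub>cohn_ring m\<^esub> (\<Sum>y\<in>carrier G. Y (\<one>, 0) (y, 0))"
    by simp
  show "(\<Sum>y\<in>carrier G. (X \<oplus>\<^bsub>block_alg\<^esub> Y) (\<one>, 0) (y, 0)) =
      (\<Sum>y\<in>carrier G. X (\<one>, 0) (y, 0)) \<oplus>\<^bsub>cohn_ring m\<^esub> (\<Sum>y\<in>carrier G. Y (\<one>, 0) (y, 0))"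
    by (simp add: sum.distrib)
next
  show "(\<Sum>y\<in>carrier G. \<one>\<^bsub>block_alg\<^esub> (\<one>, 0) (y, 0)) = \<one>\<^bsub>cohn_ring m\<^esub>"
    using finite_G by simp
qed

lemma mat_mul_row_single:
  assumes "a \<in> Idx" "\<And>r. r \<in> Idx \<Longrightarrow> r \<noteq> a \<Longrightarrow> U p r = 0"
  shows "mat_mul U Y p q = mul (level p) (U p a) (Y a q)"
proof -
  have "mat_mul U Y p q = (\<Sum>r\<in>Idx. if r = a then mul (level p) (U p a) (Y a q) else 0)"
    unfolding mat_mul_def using assms(2) by (intro sum.cong refl) auto
  then show ?thesis using assms(1) finite_Idx by simp
qed

text \<open>In degree \<open>\<one>\<close> the matrices over $S_n$ are block diagonal, and the block of degree \<open>\<one>\<close> has size one.\<close>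

lemma corner_hom: "(\<lambda>X. X (\<one>, 1) (\<one>, 1)) \<in> ring_hom block_alg1 (cohn_ring n)"
proof (rule ring_hom_memI)
  have a: "(\<one>, 1) \<in> Idx" by (simp add: Idx_def)
  fix X assume "X \<in> carrier block_alg1"
  then have X: "X \<in> component \<one>" by simp
  show "X (\<one>, 1) (\<one>, 1) \<in> carrier (cohn_ring n)" using block_mats_reduced[OF componentD(1)[OF X]] by simp
  fix Y
  have "X (\<one>, 1) r = 0" if r: "r \<in> Idx" "r \<noteq> (\<one>, 1)" for r
  proof (cases "linked (\<one>, 1) r \<and> fst r = \<one>")
    case True
    then have "snd r = 1" using r(1) by (auto simp: linked_def Idx_def)
    then have "r = (\<one>, 1)" using True by (simp add: prod_eq_iff)
    then show ?thesis using r(2) by blast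
  next
    case False
    then show ?thesis
      using block_mats_unlinked[OF componentD(1)[OF X], of "(\<one>, 1)" r] componentD(2)[OF X, of r "(\<one>, 1)"] by auto
  qed
  then have "mat_mul X Y (\<one>, 1) (\<one>, 1) = mul (level (\<one>, 1)) (X (\<one>, 1) (\<one>, 1)) (Y (\<one>, 1) (\<one>, 1))"
    by (rule mat_mul_row_single[OF a])
  then show "(X \<otimes>\<^bsub>block_alg1\<^esub> Y) (\<one>, 1) (\<one>, 1) = X (\<one>, 1) (\<one>, 1) \<otimes>\<^bsub>cohn_ring n\<^esub> Y (\<one>, 1) (\<one>, 1)"
    by (simp add: level_def)
  show "(X \<oplus>\<^bsub>block_alg1\<^esub> Y) (\<one>, 1) (\<one>, 1) = X (\<one>, 1) (\<one>, 1) \<oplus>\<^bsub>cohn_ring n\<^esub> Y (\<one>, 1) (\<one>, 1)"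
    by simp
next
  show "\<one>\<^bsub>block_alg1\<^esub> (\<one>, 1) (\<one>, 1) = \<one>\<^bsub>cohn_ring n\<^esub>" by (simp add: Idx_def)
qed

lemma block_alg1_finsum_entry:
  assumes "finite A" "\<And>a. a \<in> A \<Longrightarrow> f a \<in> component \<one>"
  shows "finsum block_alg1 f A p q = (\<Sum>a\<in>A. f a p q)"
  using assms
proof (induction A rule: finite_induct)
  case empty
  interpret R: ring block_alg1 by (rule ring_block_alg1)
  show ?case by simp
next
  case (insert a A)
  interpret R: ring block_alg1 by (rule ring_block_alg1)
  have "finsum block_alg1 f (insert a A) = f a \<oplus>\<^bsub>block_alg1\<^esub> finsum block_alg1 f A"
    using insert by (intro R.finsum_insert) auto
  then show ?case using insert by simp
qed

text \<open>Diagonal matrices with the generators of the respective coefficient ring as entries. The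
generators of $S_m$ are padded with zeros from \<open>m\<close> to \<open>n\<close>.\<close>

lemma block_alg1_matrices: "retraction_matrices block_alg1 n"
proof -
  define a where "a l k p q = (if p = q \<and> p \<in> Idx \<and> k < level p then mon [Avar l k] else 0)" for l k p q
  define b where "b k j p q = (if p = q \<and> p \<in> Idx \<and> k < level p then mon [Bvar k j] else 0)" for k j p q
  have a: "a l k \<in> component \<one>" for l k
    by (intro componentI block_matsI) (auto simp: a_def linked_def level_def Idx_fst split: if_splits)
  have b: "b k j \<in> component \<one>" for k j
    by (intro componentI block_matsI) (auto simp: b_def linked_def level_def Idx_fst split: if_splits)
  have ab: "mat_mul (a l k) (b k j) \<in> component \<one>" for l k j
    using mat_mul_component[OF a b] by simp
  have "finsum block_alg1 (\<lambda>k. mat_mul (a l k) (b k j)) {..<n} p q =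
      (if l = j then \<one>\<^bsub>block_alg\<^esub> else \<zero>\<^bsub>block_alg\<^esub>) p q" for l j p q
  proof -
    have "finsum block_alg1 (\<lambda>k. mat_mul (a l k) (b k j)) {..<n} p q = (\<Sum>k<n. mat_mul (a l k) (b k j) p q)"
      by (rule block_alg1_finsum_entry) (simp_all add: ab)
    also have "\<dots> = (if l = j then \<one>\<^bsub>block_alg\<^esub> else \<zero>\<^bsub>block_alg\<^esub>) p q"
    proof (cases "p \<in> Idx \<and> p = q")
      case True
      have "mat_mul (a l k) (b k j) p q = mul (level p) (a l k p p) (b k j p q)" for k
        using True by (intro mat_mul_row_single) (auto simp: a_def)
      then have "(\<Sum>k<n. mat_mul (a l k) (b k j) p q) =
          (\<Sum>k<level p. mul (level p) (mon [Avar l k]) (mon [Bvar k j]))"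
        using True m_le_n
        by (intro sum.mono_neutral_cong_right) (auto simp: a_def b_def level_def)
      then show ?thesis
        using mul_relation[of "level p" l j] True m_pos m_le_n by (auto simp: level_def)
    next
      case False
      have "mat_mul (a l k) (b k j) p q = 0" for k
        unfolding mat_mul_def using False by (intro sum.neutral) (auto simp: a_def b_def)
      then show ?thesis using False by auto
    qed
    finally show ?thesis .
  qed
  then have "finsum block_alg1 (\<lambda>k. mat_mul (a l k) (b k j)) {..<n} = (if l = j then \<one>\<^bsub>block_alg\<^esub> else \<zero>\<^bsub>block_alg\<^esub>)" for l j
    by (intro ext)
  then show ?thesis
    unfolding retraction_matrices_def using a b
    by (intro exI[of _ a] exI[of _ b] conjI allI impI) (simp_all del: block_alg_simps(4,5))
qed

text \<open>On $S_m[G]$ the generators of $S_m$ do. In $M_I(S_n)$ even two sequences of elements with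
$a_l b_j = \delta_{lj}$ exist: the rows of $a_l$ are supported on the \<open>n\<close> columns of degree \<open>g0\<close>, and the
row of index \<open>p\<close> is the row of the generators $(a_{rk})_k$ of $S_n$, where the number $r$ encodes
\<open>l\<close> and \<open>p\<close>.\<close>

lemma block_alg_matrices:
  assumes g0: "g0 \<in> carrier G" "g0 \<noteq> \<one>"
  shows "retraction_matrices block_alg m"
proof -
  define enc where "enc l p = prod_encode (l, prod_encode (to_nat_on (carrier G) (fst p), snd p))"
    for l and p :: "'g \<times> nat"
  have enc_eq: "enc l p = enc j q \<longleftrightarrow> l = j \<and> p = q" if "p \<in> Idx" "q \<in> Idx" for l j p q
    using that Idx_fst[of p] Idx_fst[of q] countable_finite[OF finite_G]
    by (auto simp: enc_def prod_eq_iff)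
  define a where "a l k p q =
      (if p = q \<and> p \<in> Idx \<and> snd p = 0 then mon [Avar l k]
       else if k = 0 \<and> p \<in> Idx \<and> q \<in> Idx \<and> snd p \<noteq> 0 \<and> fst q = g0 \<and> snd q \<noteq> 0
         then mon [Avar (enc l p) (snd q - 1)] else 0)" for l k p q
  define b where "b k j p q =
      (if p = q \<and> p \<in> Idx \<and> snd p = 0 then mon [Bvar k j]
       else if k = 0 \<and> p \<in> Idx \<and> q \<in> Idx \<and> fst p = g0 \<and> snd p \<noteq> 0 \<and> snd q \<noteq> 0
         then mon [Bvar (snd p - 1) (enc j q)] else 0)" for k j p q
  have a: "a l k \<in> block_mats" for l k
    by (intro block_matsI) (auto simp: a_def linked_def)
  have b: "b k j \<in> block_mats" for k j
    by (intro block_matsI) (auto simp: b_def linked_def)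
  have "finsum block_alg (\<lambda>k. mat_mul (a l k) (b k j)) {..<m} p q =
      (if l = j then \<one>\<^bsub>block_alg\<^esub> else \<zero>\<^bsub>block_alg\<^esub>) p q" for l j p q
  proof -
    have "finsum block_alg (\<lambda>k. mat_mul (a l k) (b k j)) {..<m} p q = (\<Sum>k<m. mat_mul (a l k) (b k j) p q)"
      by (rule block_alg_finsum_entry) (simp_all add: mat_mul_closed a b)
    also have "\<dots> = (if l = j then \<one>\<^bsub>block_alg\<^esub> else \<zero>\<^bsub>block_alg\<^esub>) p q"
    proof -
      consider "p \<notin> Idx" | "p \<in> Idx" "snd p = 0" | "p \<in> Idx" "snd p \<noteq> 0" by blast
      then show ?thesis
      proof cases
        case 1
        then have "mat_mul (a l k) (b k j) p q = 0" for k
          by (intro mat_mul_row_0) (simp add: a_def)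
        then show ?thesis using 1 by simp
      next
        case 2
        have "mat_mul (a l k) (b k j) p q = (if p = q then mul m (mon [Avar l k]) (mon [Bvar k j]) else 0)" for k
        proof -
          have "mat_mul (a l k) (b k j) p q = mul (level p) (a l k p p) (b k j p q)"
            using 2 by (intro mat_mul_row_single) (auto simp: a_def)
          then show ?thesis using 2 by (simp add: a_def b_def level_def)
        qed
        then show ?thesis using mul_relation[OF m_pos, of l j] 2 by (cases "p = q"; cases "l = j") simp_all
      next
        case 3
        have z: "mat_mul (a l k) (b k j) p q = 0" if "k \<noteq> 0" for k
          by (rule mat_mul_row_0) (use 3 that in \<open>simp add: a_def\<close>)
        have "(\<Sum>k<m. mat_mul (a l k) (b k j) p q) = (\<Sum>k\<in>{0}. mat_mul (a l k) (b k j) p q)"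
          using m_pos z by (intro sum.mono_neutral_right) auto
        also have "\<dots> = (\<Sum>r\<in>(\<lambda>i. (g0, Suc i)) ` {..<n}. mul n (a l 0 p r) (b 0 j r q))"
          unfolding mat_mul_def
        proof -
          have sub: "(\<lambda>i. (g0, Suc i)) ` {..<n} \<subseteq> Idx" using g0 by (auto simp: Idx_def)
          have zero: "a l 0 p r = 0" if r: "r \<in> Idx - (\<lambda>i. (g0, Suc i)) ` {..<n}" for r
          proof -
            have "\<not> (fst r = g0 \<and> snd r \<noteq> 0)"
            proof
              assume *: "fst r = g0 \<and> snd r \<noteq> 0"
              then have "snd r \<le> n" using r g0 by (auto simp: Idx_def)
              then have "r = (g0, Suc (snd r - 1)) \<and> snd r - 1 < n" using * by (auto simp: prod_eq_iff)
              then show False using r by blast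
            qed
            then show ?thesis using 3 by (auto simp: a_def)
          qed
          show "(\<Sum>k\<in>{0}. \<Sum>r\<in>Idx. mul (level p) (a l k p r) (b k j r q)) =
              (\<Sum>r\<in>(\<lambda>i. (g0, Suc i)) ` {..<n}. mul n (a l 0 p r) (b 0 j r q))"
            using sum.mono_neutral_right[OF finite_Idx sub, of "\<lambda>r. mul n (a l 0 p r) (b 0 j r q)"] zero 3
            by (simp add: level_def)
        qed
        also have "\<dots> = (\<Sum>i<n. mul n (a l 0 p (g0, Suc i)) (b 0 j (g0, Suc i) q))"
          by (subst sum.reindex) (auto simp: inj_on_def)
        also have "\<dots> = (if p = q \<and> l = j then mon [] else 0)"
        proof (cases "q \<in> Idx \<and> snd q \<noteq> 0")
          case True
          have "(\<Sum>i<n. mul n (a l 0 p (g0, Suc i)) (b 0 j (g0, Suc i) q)) =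
              (\<Sum>i<n. mul n (mon [Avar (enc l p) i]) (mon [Bvar i (enc j q)]))"
            using 3 True g0 by (intro sum.cong refl) (simp add: a_def b_def Idx_def del: mul_mon)
          also have "\<dots> = (if enc l p = enc j q then mon [] else 0)"
            using m_pos m_le_n by (intro mul_relation) simp
          finally show ?thesis using enc_eq[OF 3(1), of q l j] True by auto
        next
          case False
          then have "b 0 j (g0, Suc i) q = 0" for i by (auto simp: b_def)
          then show ?thesis using False 3 by auto
        qed
        finally show ?thesis using 3 by auto
      qed
    qed
    finally show ?thesis .
  qed
  then have "finsum block_alg (\<lambda>k. mat_mul (a l k) (b k j)) {..<m} = (if l = j then \<one>\<^bsub>block_alg\<^esub> else \<zero>\<^bsub>block_alg\<^esub>)" for l j
    by (intro ext)
  then show ?thesis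
    unfolding retraction_matrices_def using a b
    by (intro exI[of _ a] exI[of _ b] conjI allI impI) (simp_all del: block_alg_simps(4,5))
qed

end

theorem proposition4p9:
  fixes G :: "('g, 'h) monoid_scheme" and m n :: nat
  assumes "group G" and "finite (carrier G)" and "carrier G \<noteq> {\<one>\<^bsub>G\<^esub>}"
    and "0 < m" and "m \<le> n"
  shows "\<exists>(R :: nat ring) (C :: 'g \<Rightarrow> nat set).
    strongly_graded_ring R G C \<and> gn (base_ring R G C) = enat n \<and> gn R = enat m"
proof -
  interpret block_ring G m n
    using assms by (intro block_ring.intro block_ring_axioms.intro)
  obtain g0 where g0: "g0 \<in> carrier G" "g0 \<noteq> \<one>\<^bsub>G\<^esub>" using assms(3) one_closed by blast
  define \<phi> where "\<phi> = to_nat_on block_mats"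
  define \<psi> where "\<psi> = inv_into (carrier block_alg) \<phi>"
  define R where "R = image_ring \<phi> block_alg"
  define C where "C g = \<phi> ` component g" for g
  have inj: "inj_on \<phi> (carrier block_alg)"
    using inj_on_to_nat_on[OF countable_block_mats] by (simp add: \<phi>_def)
  have R: "ring R" unfolding R_def by (rule ring.inj_imp_image_ring_is_ring[OF ring_block_alg inj])
  have iso: "\<phi> \<in> ring_iso block_alg R" unfolding R_def by (rule inj_imp_image_ring_iso[OF inj])
  then have \<phi>: "\<phi> \<in> ring_hom block_alg R" by (simp add: ring_iso_def)
  have \<psi>: "\<psi> \<in> ring_hom R block_alg"
    using ring_iso_set_sym[OF ring_block_alg iso] by (simp add: ring_iso_def \<psi>_def)
  have \<psi>\<phi>: "\<psi> (\<phi> X) = X" if "X \<in> block_mats" for X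
    using inj that by (simp add: \<psi>_def)
  have "strongly_graded_ring R G C"
    using strongly_graded_ring_image[OF strongly_graded_block_alg inj] by (simp add: R_def C_def[abs_def])
  moreover have "gn R = enat m"
  proof (rule gn_eqI[OF R m_pos])
    show "retraction_matrices R m"
      by (rule retraction_matrices_hom[OF ring_block_alg R \<phi> block_alg_matrices[OF g0]])
    show "\<not> retraction_matrices R k" if "k < m" for k
      using retraction_matrices_hom[OF R ring_block_alg \<psi>]
        retraction_matrices_hom[OF ring_block_alg ring_cohn_ring augmentation_hom] cohn_ring_no_matrices[OF that]
      by blast
  qed
  moreover have "gn (base_ring R G C) = enat n"
  proof -
    have sub: "subring (C \<one>\<^bsub>G\<^esub>) R"
      unfolding C_def
      by (rule ring_hom_ring.img_is_subring[OF ring_hom_ringI2[OF ring_block_alg R \<phi>] subring_component_one])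
    have B: "ring (R\<lparr>carrier := C \<one>\<^bsub>G\<^esub>\<rparr>)" by (rule ring.subring_is_ring[OF R sub])
    have CR: "C \<one>\<^bsub>G\<^esub> \<subseteq> carrier R" by (rule subringE(1)[OF sub])
    have \<phi>1: "\<phi> \<in> ring_hom block_alg1 (R\<lparr>carrier := C \<one>\<^bsub>G\<^esub>\<rparr>)"
      using ring_hom_memE[OF \<phi>] componentD(1) by (intro ring_hom_memI) (auto simp: C_def)
    have \<psi>1: "\<psi> \<in> ring_hom (R\<lparr>carrier := C \<one>\<^bsub>G\<^esub>\<rparr>) block_alg1"
      using ring_hom_memE[OF \<psi>] CR componentD(1) \<psi>\<phi>
      by (intro ring_hom_memI) (auto simp: C_def subset_iff)
    have "gn (R\<lparr>carrier := C \<one>\<^bsub>G\<^esub>\<rparr>) = enat n"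
    proof (rule gn_eqI[OF B])
      show "0 < n" using m_pos m_le_n by simp
      show "retraction_matrices (R\<lparr>carrier := C \<one>\<^bsub>G\<^esub>\<rparr>) n"
        by (rule retraction_matrices_hom[OF ring_block_alg1 B \<phi>1 block_alg1_matrices])
      show "\<not> retraction_matrices (R\<lparr>carrier := C \<one>\<^bsub>G\<^esub>\<rparr>) k" if "k < n" for k
        using retraction_matrices_hom[OF B ring_block_alg1 \<psi>1]
          retraction_matrices_hom[OF ring_block_alg1 ring_cohn_ring corner_hom] cohn_ring_no_matrices[OF that]
        by blast
    qed
    then show ?thesis by (simp add: base_ring_def)
  qed
  ultimately show ?thesis by blast
qed

end
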